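(* ${\sf RCA}_0$ can prove ${\sf RT}(2,4)$ with one typical use of ${\sf RT}(2,2)$.
   Context: ${\sf RCA}_0$ is the standard classical base system of second-order reverse mathematics. ${\sf RT}(2,k)$ states: for every $f:[\mathbb{N}]^2\to k$ there is an infinite set $x\subseteq\mathbb{N}$ and $i<k$ with $f([x]^2)=\{i\}$; both are viewed as problems $\forall f\,(0=0\to\exists x\,p_2(f,x))$ where $x$ codes the color and an increasing enumeration of the monochromatic set. A theory $\mathcal{T}$ proves ${\sf Q}:\forall u\,(q_1(u)\to\exists v\,q_2(u,v))$ with one typical use of ${\sf P}:\forall x\,(p_1(x)\to\exists y\,p_2(x,y))$ if: (i) for a variable $u$ there is a term $x_u$ such that from axioms of $\mathcal{T}$ and the assumption $q_1(u)$, with no generalization on $u$ or variables free in $x_u$, there is a deduction of $p_1(x_u)$; and (ii) for a fresh constant $y_0$ there is a term $v_{x_u,y_0}$ such that from axioms of $\mathcal{T}$ and the assumption $p_2(x_u,y_0)$, with no generalization on $u$ or variables free in $x_u$ or $v_{x_u,y_0}$, there is a deduction of $q_2(u,v_{x_u,y_0})$. *)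

theory Defs
  imports Main
begin

section \<open>The language of second-order arithmetic\<close>

text \<open>
  The two-sorted first-order language of second-order arithmetic with named variables. The
  individual constants NCon and SCon do not belong to the language proper: they are the supply of new
  constants for deductions. Equality of sets is not primitive.
\<close>

datatype nterm =
    NVar nat | NCon nat | Zero | One
  | Plus nterm nterm | Times nterm nterm

datatype sterm = SVar nat | SCon nat

datatype fm =
    Eq nterm nterm | Less nterm nterm | Mem nterm sterm
  | Neg fm | Imp fm fm | AllN nat fm | AllS nat fm

abbreviation Conj :: "fm \<Rightarrow> fm \<Rightarrow> fm" where "Conj A B \<equiv> Neg (Imp A (Neg B))"
abbreviation Disj :: "fm \<Rightarrow> fm \<Rightarrow> fm" where "Disj A B \<equiv> Imp (Neg A) B"
abbreviation Iff :: "fm \<Rightarrow> fm \<Rightarrow> fm" where "Iff A B \<equiv> Conj (Imp A B) (Imp B A)"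
abbreviation ExN :: "nat \<Rightarrow> fm \<Rightarrow> fm" where "ExN x A \<equiv> Neg (AllN x (Neg A))"
abbreviation ExS :: "nat \<Rightarrow> fm \<Rightarrow> fm" where "ExS X A \<equiv> Neg (AllS X (Neg A))"

fun fv_nterm :: "nterm \<Rightarrow> nat set" where
  "fv_nterm (NVar x) = {x}"
| "fv_nterm (NCon c) = {}"
| "fv_nterm Zero = {}"
| "fv_nterm One = {}"
| "fv_nterm (Plus s t) = fv_nterm s \<union> fv_nterm t"
| "fv_nterm (Times s t) = fv_nterm s \<union> fv_nterm t"

fun con_nterm :: "nterm \<Rightarrow> nat set" where
  "con_nterm (NVar x) = {}"
| "con_nterm (NCon c) = {c}"
| "con_nterm Zero = {}"
| "con_nterm One = {}"
| "con_nterm (Plus s t) = con_nterm s \<union> con_nterm t"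
| "con_nterm (Times s t) = con_nterm s \<union> con_nterm t"

fun fv_sterm :: "sterm \<Rightarrow> nat set" where
  "fv_sterm (SVar X) = {X}"
| "fv_sterm (SCon C) = {}"

fun con_sterm :: "sterm \<Rightarrow> nat set" where
  "con_sterm (SVar X) = {}"
| "con_sterm (SCon C) = {C}"

fun fvN :: "fm \<Rightarrow> nat set" where
  "fvN (Eq s t) = fv_nterm s \<union> fv_nterm t"
| "fvN (Less s t) = fv_nterm s \<union> fv_nterm t"
| "fvN (Mem t S) = fv_nterm t"
| "fvN (Neg A) = fvN A"
| "fvN (Imp A B) = fvN A \<union> fvN B"
| "fvN (AllN x A) = fvN A - {x}"
| "fvN (AllS X A) = fvN A"

fun fvS :: "fm \<Rightarrow> nat set" where
  "fvS (Eq s t) = {}"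
| "fvS (Less s t) = {}"
| "fvS (Mem t S) = fv_sterm S"
| "fvS (Neg A) = fvS A"
| "fvS (Imp A B) = fvS A \<union> fvS B"
| "fvS (AllN x A) = fvS A"
| "fvS (AllS X A) = fvS A - {X}"

fun conN :: "fm \<Rightarrow> nat set" where
  "conN (Eq s t) = con_nterm s \<union> con_nterm t"
| "conN (Less s t) = con_nterm s \<union> con_nterm t"
| "conN (Mem t S) = con_nterm t"
| "conN (Neg A) = conN A"
| "conN (Imp A B) = conN A \<union> conN B"
| "conN (AllN x A) = conN A"
| "conN (AllS X A) = conN A"

fun conS :: "fm \<Rightarrow> nat set" where
  "conS (Eq s t) = {}"
| "conS (Less s t) = {}"
| "conS (Mem t S) = con_sterm S"
| "conS (Neg A) = conS A"
| "conS (Imp A B) = conS A \<union> conS B"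
| "conS (AllN x A) = conS A"
| "conS (AllS X A) = conS A"

text \<open>
  Simultaneous substitution for free variables. Bound variables are not renamed, so that its uses are
  guarded by the usual proviso that the terms are free for the variables they replace.
\<close>

fun sub_nterm :: "(nat \<Rightarrow> nterm) \<Rightarrow> nterm \<Rightarrow> nterm" where
  "sub_nterm \<sigma> (NVar x) = \<sigma> x"
| "sub_nterm \<sigma> (NCon c) = NCon c"
| "sub_nterm \<sigma> Zero = Zero"
| "sub_nterm \<sigma> One = One"
| "sub_nterm \<sigma> (Plus s t) = Plus (sub_nterm \<sigma> s) (sub_nterm \<sigma> t)"
| "sub_nterm \<sigma> (Times s t) = Times (sub_nterm \<sigma> s) (sub_nterm \<sigma> t)"

fun sub_sterm :: "(nat \<Rightarrow> sterm) \<Rightarrow> sterm \<Rightarrow> sterm" where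
  "sub_sterm \<sigma> (SVar X) = \<sigma> X"
| "sub_sterm \<sigma> (SCon C) = SCon C"

fun subN :: "(nat \<Rightarrow> nterm) \<Rightarrow> fm \<Rightarrow> fm" where
  "subN \<sigma> (Eq s t) = Eq (sub_nterm \<sigma> s) (sub_nterm \<sigma> t)"
| "subN \<sigma> (Less s t) = Less (sub_nterm \<sigma> s) (sub_nterm \<sigma> t)"
| "subN \<sigma> (Mem t S) = Mem (sub_nterm \<sigma> t) S"
| "subN \<sigma> (Neg A) = Neg (subN \<sigma> A)"
| "subN \<sigma> (Imp A B) = Imp (subN \<sigma> A) (subN \<sigma> B)"
| "subN \<sigma> (AllN x A) = AllN x (subN (\<sigma>(x := NVar x)) A)"
| "subN \<sigma> (AllS X A) = AllS X (subN \<sigma> A)"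

fun subS :: "(nat \<Rightarrow> sterm) \<Rightarrow> fm \<Rightarrow> fm" where
  "subS \<sigma> (Eq s t) = Eq s t"
| "subS \<sigma> (Less s t) = Less s t"
| "subS \<sigma> (Mem t S) = Mem t (sub_sterm \<sigma> S)"
| "subS \<sigma> (Neg A) = Neg (subS \<sigma> A)"
| "subS \<sigma> (Imp A B) = Imp (subS \<sigma> A) (subS \<sigma> B)"
| "subS \<sigma> (AllN x A) = AllN x (subS \<sigma> A)"
| "subS \<sigma> (AllS X A) = AllS X (subS (\<sigma>(X := SVar X)) A)"

fun free_forN :: "(nat \<Rightarrow> nterm) \<Rightarrow> fm \<Rightarrow> bool" where
  "free_forN \<sigma> (Eq s t) = True"
| "free_forN \<sigma> (Less s t) = True"
| "free_forN \<sigma> (Mem t S) = True"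
| "free_forN \<sigma> (Neg A) = free_forN \<sigma> A"
| "free_forN \<sigma> (Imp A B) = (free_forN \<sigma> A \<and> free_forN \<sigma> B)"
| "free_forN \<sigma> (AllN x A) =
     ((\<forall>y \<in> fvN A - {x}. x \<notin> fv_nterm (\<sigma> y)) \<and> free_forN (\<sigma>(x := NVar x)) A)"
| "free_forN \<sigma> (AllS X A) = free_forN \<sigma> A"

fun free_forS :: "(nat \<Rightarrow> sterm) \<Rightarrow> fm \<Rightarrow> bool" where
  "free_forS \<sigma> (Eq s t) = True"
| "free_forS \<sigma> (Less s t) = True"
| "free_forS \<sigma> (Mem t S) = True"
| "free_forS \<sigma> (Neg A) = free_forS \<sigma> A"
| "free_forS \<sigma> (Imp A B) = (free_forS \<sigma> A \<and> free_forS \<sigma> B)"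
| "free_forS \<sigma> (AllN x A) = free_forS \<sigma> A"
| "free_forS \<sigma> (AllS X A) =
     ((\<forall>Y \<in> fvS A - {X}. X \<notin> fv_sterm (\<sigma> Y)) \<and> free_forS (\<sigma>(X := SVar X)) A)"

section \<open>Deductions\<close>

text \<open>
  A Hilbert-style calculus for classical two-sorted predicate logic with equality on numbers, whose
  rules are modus ponens and generalization.
\<close>

inductive_set logical_axioms :: "fm set" where
  K: "Imp A (Imp B A) \<in> logical_axioms"
| S: "Imp (Imp A (Imp B C)) (Imp (Imp A B) (Imp A C)) \<in> logical_axioms"
| Classical: "Imp (Imp (Neg B) (Neg A)) (Imp (Imp (Neg B) A) B) \<in> logical_axioms"
| InstN: "free_forN (NVar(x := t)) A \<Longrightarrow>
     Imp (AllN x A) (subN (NVar(x := t)) A) \<in> logical_axioms"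
| InstS: "free_forS (SVar(X := U)) A \<Longrightarrow>
     Imp (AllS X A) (subS (SVar(X := U)) A) \<in> logical_axioms"
| DistN: "x \<notin> fvN A \<Longrightarrow>
     Imp (AllN x (Imp A B)) (Imp A (AllN x B)) \<in> logical_axioms"
| DistS: "X \<notin> fvS A \<Longrightarrow>
     Imp (AllS X (Imp A B)) (Imp A (AllS X B)) \<in> logical_axioms"
| EqRefl: "Eq t t \<in> logical_axioms"
| EqSubst: "free_forN (NVar(x := s)) A \<Longrightarrow> free_forN (NVar(x := t)) A \<Longrightarrow>
     Imp (Eq s t) (Imp (subN (NVar(x := s)) A) (subN (NVar(x := t)) A)) \<in> logical_axioms"

text \<open>
  Deductions may name witnesses of existential statements already deduced by new constants
  (Rule C, as in Mendelson's textbook). A deduction is recorded, latest entry first, by its lines L and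
  by the list W of those existential formulas to which Rule C has been applied; by the usual proviso,
  variables free in a formula of W are not generalized afterwards. In ded T G V s s' the deduction s is
  continued to s' using axioms from T and assumptions from G, without generalizing on any set
  variable in V.
\<close>

inductive ded ::
  "fm set \<Rightarrow> fm set \<Rightarrow> nat set \<Rightarrow> fm list \<times> fm list \<Rightarrow> fm list \<times> fm list \<Rightarrow> bool"
  for T G :: "fm set" and V :: "nat set" and s :: "fm list \<times> fm list" where
  Start: "ded T G V s s"
| Axiom: "ded T G V s (L, W) \<Longrightarrow> A \<in> T \<union> logical_axioms \<Longrightarrow> ded T G V s (A # L, W)"
| Assumption: "ded T G V s (L, W) \<Longrightarrow> A \<in> G \<Longrightarrow> ded T G V s (A # L, W)"
| MP: "ded T G V s (L, W) \<Longrightarrow> Imp A B \<in> set L \<Longrightarrow> A \<in> set L \<Longrightarrow> ded T G V s (B # L, W)"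
| GenN: "ded T G V s (L, W) \<Longrightarrow> A \<in> set L \<Longrightarrow> \<forall>B \<in> set W. x \<notin> fvN B \<Longrightarrow>
     ded T G V s (AllN x A # L, W)"
| GenS: "ded T G V s (L, W) \<Longrightarrow> A \<in> set L \<Longrightarrow> X \<notin> V \<Longrightarrow> \<forall>B \<in> set W. X \<notin> fvS B \<Longrightarrow>
     ded T G V s (AllS X A # L, W)"
| RuleCN: "ded T G V s (L, W) \<Longrightarrow> ExN x A \<in> set L \<Longrightarrow> \<forall>B \<in> set L \<union> T \<union> G. c \<notin> conN B \<Longrightarrow>
     ded T G V s (subN (NVar(x := NCon c)) A # L, ExN x A # W)"
| RuleCS: "ded T G V s (L, W) \<Longrightarrow> ExS X A \<in> set L \<Longrightarrow> \<forall>B \<in> set L \<union> T \<union> G. C \<notin> conS B \<Longrightarrow>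
     ded T G V s (subS (SVar(X := SCon C)) A # L, ExS X A # W)"

section \<open>One typical use\<close>

text \<open>
  A problem is a sentence of the form: for all X, if pre then there is Y with post. Here X and Y are
  the set variables inp and out, the only variables free in post, and pre has at most X free.
\<close>

record problem =
  inp :: nat
  out :: nat
  pre :: fm
  post :: fm

text \<open>
  The theory T proves Q with one typical use of P. The language of second-order arithmetic has no
  set terms besides variables, so a set constructed in a deduction (by comprehension, say) can only be
  named by applying Rule C. For the term x to denote the same set in both deductions, they have a
  common beginning s0, which uses no assumption besides the axioms of T.
\<close>

definition one_typical_use :: "fm set \<Rightarrow> problem \<Rightarrow> problem \<Rightarrow> bool" where
  "one_typical_use T Q P \<longleftrightarrow>
     (\<exists>u x y0 v L0 W0 L1 W1 L2 W2.
        let q1 = subS (SVar(inp Q := SVar u)) (pre Q);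
            p1 = subS (SVar(inp P := x)) (pre P);
            p2 = subS (SVar(inp P := x, out P := SCon y0)) (post P);
            q2 = subS (SVar(inp Q := SVar u, out Q := v)) (post Q)
        in
          free_forS (SVar(inp Q := SVar u)) (pre Q) \<and>
          free_forS (SVar(inp P := x)) (pre P) \<and>
          free_forS (SVar(inp P := x, out P := SCon y0)) (post P) \<and>
          free_forS (SVar(inp Q := SVar u, out Q := v)) (post Q) \<and>
          y0 \<notin> con_sterm x \<and>
          (\<forall>B \<in> set L0 \<union> T \<union> {pre P, post P, pre Q, post Q}. y0 \<notin> conS B) \<and>
          ded T {} ({u} \<union> fv_sterm x \<union> fv_sterm v) ([], []) (L0, W0) \<and>
          ded T {q1} ({u} \<union> fv_sterm x) (L0, W0) (L1, W1) \<and> p1 \<in> set L1 \<and>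
          ded T {p2} ({u} \<union> fv_sterm x \<union> fv_sterm v) (L0, W0) (L2, W2) \<and> q2 \<in> set L2)"

section \<open>The axioms of RCA0\<close>

inductive Sigma00 :: "fm \<Rightarrow> bool" where
  "Sigma00 (Eq s t)"
| "Sigma00 (Less s t)"
| "Sigma00 (Mem t S)"
| "Sigma00 A \<Longrightarrow> Sigma00 (Neg A)"
| "Sigma00 A \<Longrightarrow> Sigma00 B \<Longrightarrow> Sigma00 (Imp A B)"
| "Sigma00 A \<Longrightarrow> x \<notin> fv_nterm t \<Longrightarrow> Sigma00 (AllN x (Imp (Less (NVar x) t) A))"
| "Sigma00 A \<Longrightarrow> x \<notin> fv_nterm t \<Longrightarrow> Sigma00 (ExN x (Conj (Less (NVar x) t) A))"

definition Sigma01 :: "fm \<Rightarrow> bool" where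
  "Sigma01 A \<longleftrightarrow> (\<exists>x B. Sigma00 B \<and> A = ExN x B)"

definition Pi01 :: "fm \<Rightarrow> bool" where
  "Pi01 A \<longleftrightarrow> (\<exists>x B. Sigma00 B \<and> A = AllN x B)"

abbreviation succ :: "nterm \<Rightarrow> nterm" where "succ t \<equiv> Plus t One"

definition basic_axioms :: "fm set" where
  "basic_axioms =
     (let m = NVar 0; n = NVar 1 in
      {Neg (Eq (succ n) Zero),
       Imp (Eq (succ m) (succ n)) (Eq m n),
       Eq (Plus m Zero) m,
       Eq (Plus m (succ n)) (succ (Plus m n)),
       Eq (Times m Zero) Zero,
       Eq (Times m (succ n)) (Plus (Times m n) m),
       Neg (Less m Zero),
       Iff (Less m (succ n)) (Disj (Less m n) (Eq m n))})"

definition Sigma01_induction :: "fm set" where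
  "Sigma01_induction =
     {Imp (Conj (subN (NVar(n := Zero)) A)
                (AllN n (Imp A (subN (NVar(n := succ (NVar n))) A))))
          (AllN n A) | n A. Sigma01 A}"

definition Delta01_comprehension :: "fm set" where
  "Delta01_comprehension =
     {Imp (AllN n (Iff A B)) (ExS X (AllN n (Iff (Mem (NVar n) (SVar X)) A)))
      | n X A B. Sigma01 A \<and> Pi01 B \<and> X \<notin> fvS A}"

definition sentence :: "fm \<Rightarrow> bool" where
  "sentence A \<longleftrightarrow> fvN A = {} \<and> fvS A = {} \<and> conN A = {} \<and> conS A = {}"

definition RCA0 :: "fm set" where
  "RCA0 = {B. sentence B \<and>
     (\<exists>xs Xs. \<exists>A \<in> basic_axioms \<union> Sigma01_induction \<union> Delta01_comprehension.
        B = foldr AllN xs (foldr AllS Xs A))}"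

section \<open>Ramsey's theorem for pairs\<close>

fun num :: "nat \<Rightarrow> nterm" where
  "num 0 = Zero"
| "num (Suc n) = succ (num n)"

text \<open>Simpson's pairing function \<open>(i + j)\<^sup>2 + i\<close>.\<close>

definition pair :: "nterm \<Rightarrow> nterm \<Rightarrow> nterm" where
  "pair s t = Plus (Times (Plus s t) (Plus s t)) s"

text \<open>
  F codes a function from \<open>[\<nat>]\<^sup>2\<close> to \<open>k\<close>, as the set of all codes of ((a, b), c) where \<open>a < b\<close> and c
  is the color of \<open>{a, b}\<close>.
\<close>

definition coloring :: "nat \<Rightarrow> sterm \<Rightarrow> fm" where
  "coloring k F =
     (let a = NVar 0; b = NVar 1; c = NVar 2; d = NVar 3; z = NVar 4 in
      Conj (AllN 4 (Imp (Mem z F)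
             (ExN 0 (ExN 1 (ExN 2
               (Conj (Less a b) (Conj (Less c (num k)) (Eq z (pair (pair a b) c)))))))))
     (Conj (AllN 0 (AllN 1 (Imp (Less a b) (ExN 2 (Mem (pair (pair a b) c) F)))))
           (AllN 0 (AllN 1 (AllN 2 (AllN 3
             (Imp (Conj (Mem (pair (pair a b) c) F) (Mem (pair (pair a b) d) F)) (Eq c d))))))))"

text \<open>X codes a function from \<open>\<nat>\<close> to \<open>\<nat>\<close>.\<close>

definition total_function :: "sterm \<Rightarrow> fm" where
  "total_function X =
     (let a = NVar 0; b = NVar 1; c = NVar 2; z = NVar 3 in
      Conj (AllN 3 (Imp (Mem z X) (ExN 0 (ExN 1 (Eq z (pair a b))))))
     (Conj (AllN 0 (ExN 1 (Mem (pair a b) X)))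
           (AllN 0 (AllN 1 (AllN 2
             (Imp (Conj (Mem (pair a b) X) (Mem (pair a c) X)) (Eq b c)))))))"

text \<open>
  X codes a function whose value at 0 is a color \<open>c < k\<close> and whose values at 1, 2, \<open>\<dots>\<close> are the
  increasing enumeration of an infinite set H such that F maps \<open>[H]\<^sup>2\<close> to c.
\<close>

definition monochromatic :: "nat \<Rightarrow> sterm \<Rightarrow> sterm \<Rightarrow> fm" where
  "monochromatic k F X =
     (let c = NVar 0; m = NVar 1; n = NVar 2; a = NVar 3; b = NVar 4 in
      Conj (total_function X)
           (ExN 0 (Conj (Less c (num k)) (Conj (Mem (pair Zero c) X)
             (AllN 1 (AllN 2 (AllN 3 (AllN 4
               (Imp (Conj (Less m n)
                    (Conj (Mem (pair (succ m) a) X) (Mem (pair (succ n) b) X)))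
                    (Conj (Less a b) (Mem (pair (pair a b) c) F)))))))))))"

text \<open>
  The precondition is the trivial formula \<open>0 = 0\<close>. As set variables range over all sets, the
  restriction of the input to codes of colorings is therefore part of post.
\<close>

definition RT2 :: "nat \<Rightarrow> problem" where
  "RT2 k =
     \<lparr>inp = 0, out = 1, pre = Eq Zero Zero,
      post = Imp (coloring k (SVar 0)) (monochromatic k (SVar 0) (SVar 1))\<rparr>"

end

theory Submission
  imports Defs "HOL-Library.Countable_Set"
begin

text \<open>
  A deduction can be extracted from validity by the completeness theorem, for which Henkin's
  construction uses the constants of the language as witnesses. So let a 4-coloring \<open>f\<close> in a model of
  RCA0 be given, whose colors are \<open>2c + d\<close> with \<open>c, d < 2\<close>, and let \<open>g\<close> be the 2-coloring by \<open>c\<close>. If \<open>g\<close>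
  has no monochromatic set in the model, use RT(2,2) on \<open>x = g\<close>, which is contradictory. Otherwise
  \<open>g\<close> has constant color \<open>c\<close> on the range of an enumeration \<open>h\<close>; use RT(2,2) on the coloring \<open>x\<close> of
  \<open>{m, n}\<close> by the digit \<open>d\<close> of \<open>f\<close> at \<open>{h m, h n}\<close>. A monochromatic enumeration \<open>y\<close> for \<open>x\<close> yields
  \<open>h \<circ> y\<close> for \<open>f\<close>. Thus RCA0 proves that for all \<open>u\<close> there is \<open>x\<close> such that every solution \<open>y\<close> for \<open>x\<close>
  gives a solution \<open>v\<close> for \<open>u\<close>, and Rule C names \<open>x\<close> and \<open>v\<close>.
\<close>

section \<open>Substitution\<close>

text \<open>The obstacle is that the argument decides whether some set exists, and such a decision
  cannot select a term: deductions have no conditional set terms. It can, however, prove an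
  existential sentence. Hence the whole argument is packed into one closed sentence with quantifiers
  in the order u, x, y, v; only a few explicit lines, which instantiate it and apply Rule C, depend
  on the exact form of a typical use. Two features of the formal setting leave their mark. Validity
  can be expressed only for structures on fixed types, so the term model has to be carried over to
  the natural numbers; this requires its domain to be infinite, and the distinctness of numerals
  must be derived in the calculus itself. Further, only Delta01 comprehension is at hand. Values of
  h and y are not bounded by the codes that refer to them, but since h and y are total and
  single-valued, "some value" and "every value" say the same, which provides the two forms that
  comprehension asks for.\<close>

lemma sub_nterm_cong: "(\<And>z. z \<in> fv_nterm t \<Longrightarrow> \<sigma> z = \<tau> z) \<Longrightarrow> sub_nterm \<sigma> t = sub_nterm \<tau> t"
  by (induction t) auto

lemma sub_sterm_cong: "(\<And>Z. Z \<in> fv_sterm U \<Longrightarrow> \<sigma> Z = \<tau> Z) \<Longrightarrow> sub_sterm \<sigma> U = sub_sterm \<tau> U"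
  by (cases U) auto

lemma subN_cong: "(\<And>z. z \<in> fvN A \<Longrightarrow> \<sigma> z = \<tau> z) \<Longrightarrow> subN \<sigma> A = subN \<tau> A"
proof (induction A arbitrary: \<sigma> \<tau>)
  case (Eq s t)
  then show ?case using sub_nterm_cong[of s \<sigma> \<tau>] sub_nterm_cong[of t \<sigma> \<tau>] by auto
next
  case (Less s t)
  then show ?case using sub_nterm_cong[of s \<sigma> \<tau>] sub_nterm_cong[of t \<sigma> \<tau>] by auto
next
  case (Mem t U)
  then show ?case using sub_nterm_cong[of t \<sigma> \<tau>] by auto
next
  case (Imp A B)
  have "subN \<sigma> A = subN \<tau> A"
    by (rule Imp.IH(1), rule Imp.prems) simp
  moreover have "subN \<sigma> B = subN \<tau> B"
    by (rule Imp.IH(2), rule Imp.prems) simp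
  ultimately show ?case by simp
next
  case (Neg A)
  have "subN \<sigma> A = subN \<tau> A"
    by (rule Neg.IH, rule Neg.prems) simp
  then show ?case by simp
next
  case (AllN x A)
  have "subN (\<sigma>(x := NVar x)) A = subN (\<tau>(x := NVar x)) A"
    using AllN.prems by (intro AllN.IH) auto
  then show ?case by simp
next
  case (AllS X A)
  have "subN \<sigma> A = subN \<tau> A" by (rule AllS.IH, rule AllS.prems) simp
  then show ?case by simp
qed

lemma subS_cong: "(\<And>Z. Z \<in> fvS A \<Longrightarrow> \<sigma> Z = \<tau> Z) \<Longrightarrow> subS \<sigma> A = subS \<tau> A"
proof (induction A arbitrary: \<sigma> \<tau>)
  case (Mem t U)
  then show ?case using sub_sterm_cong[of U \<sigma> \<tau>] by auto
next
  case (Imp A B)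
  have "subS \<sigma> A = subS \<tau> A"
    by (rule Imp.IH(1), rule Imp.prems) simp
  moreover have "subS \<sigma> B = subS \<tau> B"
    by (rule Imp.IH(2), rule Imp.prems) simp
  ultimately show ?case by simp
next
  case (Neg A)
  have "subS \<sigma> A = subS \<tau> A"
    by (rule Neg.IH, rule Neg.prems) simp
  then show ?case by simp
next
  case (AllN x A)
  have "subS \<sigma> A = subS \<tau> A" by (rule AllN.IH, rule AllN.prems) simp
  then show ?case by simp
next
  case (AllS X A)
  have "subS (\<sigma>(X := SVar X)) A = subS (\<tau>(X := SVar X)) A"
    using AllS.prems by (intro AllS.IH) auto
  then show ?case by simp
qed auto

lemma sub_nterm_NVar [simp]: "sub_nterm NVar t = t"
  by (induction t) auto

lemma sub_sterm_SVar [simp]: "sub_sterm SVar U = U"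
  by (cases U) auto

lemma subN_NVar [simp]: "subN NVar A = A"
  by (induction A) auto

lemma subS_SVar [simp]: "subS SVar A = A"
  by (induction A) auto

lemma fv_sub_nterm: "fv_nterm (sub_nterm \<sigma> t) = (\<Union>z\<in>fv_nterm t. fv_nterm (\<sigma> z))"
  by (induction t) auto

lemma fv_sub_sterm: "fv_sterm (sub_sterm \<sigma> U) = (\<Union>Z\<in>fv_sterm U. fv_sterm (\<sigma> Z))"
  by (cases U) auto

text \<open>Only an inclusion holds in general: as bound variables are not renamed, a free variable
  of \<open>\<sigma> z\<close> may be captured and disappear.\<close>

lemma fvN_subN_le: "fvN (subN \<sigma> A) \<subseteq> (\<Union>z\<in>fvN A. fv_nterm (\<sigma> z))"
proof (induction A arbitrary: \<sigma>)
  case (AllN x A)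
  have "(\<Union>z\<in>fvN A. fv_nterm ((\<sigma>(x := NVar x)) z)) \<subseteq> insert x (\<Union>z\<in>fvN A - {x}. fv_nterm (\<sigma> z))"
    by (auto split: if_splits)
  from order_trans[OF AllN.IH this] show ?case by (auto simp del: fun_upd_apply)
next
  case (Imp A B)
  show ?case using Imp.IH[of \<sigma>] by (simp add: le_supI1 le_supI2)
qed (auto simp: fv_sub_nterm)

lemma fvS_subS_le: "fvS (subS \<sigma> A) \<subseteq> (\<Union>Z\<in>fvS A. fv_sterm (\<sigma> Z))"
proof (induction A arbitrary: \<sigma>)
  case (AllS X A)
  have "(\<Union>Z\<in>fvS A. fv_sterm ((\<sigma>(X := SVar X)) Z)) \<subseteq> insert X (\<Union>Z\<in>fvS A - {X}. fv_sterm (\<sigma> Z))"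
    by (auto split: if_splits)
  from order_trans[OF AllS.IH this] show ?case by (auto simp del: fun_upd_apply)
next
  case (Imp A B)
  show ?case using Imp.IH[of \<sigma>] by (simp add: le_supI1 le_supI2)
qed (auto simp: fv_sub_sterm)

lemma fvS_subN [simp]: "fvS (subN \<sigma> A) = fvS A"
  by (induction A arbitrary: \<sigma>) auto

lemma fvN_subS [simp]: "fvN (subS \<sigma> A) = fvN A"
  by (induction A arbitrary: \<sigma>) auto

lemma con_sub_nterm_le: "con_nterm (sub_nterm \<sigma> t) \<subseteq> con_nterm t \<union> (\<Union>z. con_nterm (\<sigma> z))"
  by (induction t) auto

lemma conN_subN_le: "conN (subN \<sigma> A) \<subseteq> conN A \<union> (\<Union>z. con_nterm (\<sigma> z))"
proof (induction A arbitrary: \<sigma>)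
  case (AllN x A)
  have "(\<Union>z. con_nterm ((\<sigma>(x := NVar x)) z)) \<subseteq> (\<Union>z. con_nterm (\<sigma> z))"
    by (auto split: if_splits)
  from order_trans[OF AllN.IH Un_mono[OF order_refl this]] show ?case by (simp del: fun_upd_apply)
next
  case (Imp A B)
  show ?case using Imp.IH[of \<sigma>] by auto
qed (auto dest!: subsetD[OF con_sub_nterm_le])

lemma conS_subN [simp]: "conS (subN \<sigma> A) = conS A"
  by (induction A arbitrary: \<sigma>) auto

lemma subN_subS_commute: "subN \<sigma> (subS \<tau> A) = subS \<tau> (subN \<sigma> A)"
  by (induction A arbitrary: \<sigma> \<tau>) auto

lemma sub_nterm_comp: "sub_nterm \<tau> (sub_nterm \<sigma> t) = sub_nterm (\<lambda>z. sub_nterm \<tau> (\<sigma> z)) t"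
  by (induction t) auto

lemma sub_sterm_comp: "sub_sterm \<tau> (sub_sterm \<sigma> U) = sub_sterm (\<lambda>Z. sub_sterm \<tau> (\<sigma> Z)) U"
  by (cases U) auto

text \<open>Freeness of \<sigma> ensures that no \<open>\<sigma> z\<close> for a free z contains the
  variable of a quantifier it is moved under; resetting \<tau> at that variable is therefore
  invisible inside \<open>\<sigma> z\<close>.\<close>

lemma subN_comp:
  "free_forN \<sigma> A \<Longrightarrow> subN \<tau> (subN \<sigma> A) = subN (\<lambda>z. sub_nterm \<tau> (\<sigma> z)) A"
proof (induction A arbitrary: \<sigma> \<tau>)
  case (AllN x A)
  have "subN (\<tau>(x := NVar x)) (subN (\<sigma>(x := NVar x)) A)
      = subN (\<lambda>z. sub_nterm (\<tau>(x := NVar x)) ((\<sigma>(x := NVar x)) z)) A"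
    by (rule AllN.IH) (use AllN.prems in \<open>simp del: fun_upd_apply\<close>)
  also have "\<dots> = subN ((\<lambda>z. sub_nterm \<tau> (\<sigma> z))(x := NVar x)) A"
    using AllN.prems by (intro subN_cong) (auto intro!: sub_nterm_cong)
  finally show ?case by simp
qed (auto simp: sub_nterm_comp)

lemma subS_comp:
  "free_forS \<sigma> A \<Longrightarrow> subS \<tau> (subS \<sigma> A) = subS (\<lambda>Z. sub_sterm \<tau> (\<sigma> Z)) A"
proof (induction A arbitrary: \<sigma> \<tau>)
  case (AllS X A)
  have "subS (\<tau>(X := SVar X)) (subS (\<sigma>(X := SVar X)) A)
      = subS (\<lambda>Z. sub_sterm (\<tau>(X := SVar X)) ((\<sigma>(X := SVar X)) Z)) A"
    by (rule AllS.IH) (use AllS.prems in \<open>simp del: fun_upd_apply\<close>)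
  also have "\<dots> = subS ((\<lambda>Z. sub_sterm \<tau> (\<sigma> Z))(X := SVar X)) A"
    using AllS.prems by (intro subS_cong) (auto intro!: sub_sterm_cong)
  finally show ?case by simp
qed (auto simp: sub_sterm_comp)

section \<open>Bound variables and the absence of capture\<close>

fun bvN :: "fm \<Rightarrow> nat set" where
  "bvN (Neg A) = bvN A"
| "bvN (Imp A B) = bvN A \<union> bvN B"
| "bvN (AllN x A) = insert x (bvN A)"
| "bvN (AllS X A) = bvN A"
| "bvN _ = {}"

fun bvS :: "fm \<Rightarrow> nat set" where
  "bvS (Neg A) = bvS A"
| "bvS (Imp A B) = bvS A \<union> bvS B"
| "bvS (AllN x A) = bvS A"
| "bvS (AllS X A) = insert X (bvS A)"
| "bvS _ = {}"

lemma finite_fv_nterm [simp]: "finite (fv_nterm t)" by (induction t) auto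
lemma finite_fv_sterm [simp]: "finite (fv_sterm U)" by (cases U) auto
lemma finite_con_nterm [simp]: "finite (con_nterm t)" by (induction t) auto
lemma finite_con_sterm [simp]: "finite (con_sterm U)" by (cases U) auto
lemma finite_fvN [simp]: "finite (fvN A)" by (induction A) auto
lemma finite_fvS [simp]: "finite (fvS A)" by (induction A) auto
lemma finite_conN [simp]: "finite (conN A)" by (induction A) auto
lemma finite_conS [simp]: "finite (conS A)" by (induction A) auto
lemma finite_bvN [simp]: "finite (bvN A)" by (induction A) auto
lemma finite_bvS [simp]: "finite (bvS A)" by (induction A) auto

text \<open>Y collects the variables that \<sigma> introduces. The variable z itself is harmless in
  \<open>\<sigma> z\<close>, because a quantifier on z resets the substitution there.\<close>

lemma free_forN_if_no_capture:
  "(\<And>z. z \<in> fvN A \<Longrightarrow> fv_nterm (\<sigma> z) \<subseteq> insert z Y) \<Longrightarrow> bvN A \<inter> Y = {} \<Longrightarrow> free_forN \<sigma> A"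
proof (induction A arbitrary: \<sigma>)
  case (AllN x A)
  have "free_forN (\<sigma>(x := NVar x)) A"
    using AllN.prems by (intro AllN.IH) auto
  then show ?case using AllN.prems by fastforce
next
  case (Imp A B)
  have "free_forN \<sigma> A" "free_forN \<sigma> B"
    using Imp.prems by (auto intro!: Imp.IH simp del: subset_insert_iff)
  then show ?case by simp
qed auto

lemma free_forS_if_no_capture:
  "(\<And>Z. Z \<in> fvS A \<Longrightarrow> fv_sterm (\<sigma> Z) \<subseteq> insert Z Y) \<Longrightarrow> bvS A \<inter> Y = {} \<Longrightarrow> free_forS \<sigma> A"
proof (induction A arbitrary: \<sigma>)
  case (AllS X A)
  have "free_forS (\<sigma>(X := SVar X)) A"
    using AllS.prems by (intro AllS.IH) auto
  then show ?case using AllS.prems by fastforce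
next
  case (Imp A B)
  have "free_forS \<sigma> A" "free_forS \<sigma> B"
    using Imp.prems by (auto intro!: Imp.IH)
  then show ?case by simp
qed auto

lemma free_forN_closed: "(\<And>z. z \<in> fvN A \<Longrightarrow> fv_nterm (\<sigma> z) \<subseteq> {z}) \<Longrightarrow> free_forN \<sigma> A"
  by (rule free_forN_if_no_capture[where Y = "{}"]) auto

lemma free_forS_closed: "(\<And>Z. Z \<in> fvS A \<Longrightarrow> fv_sterm (\<sigma> Z) \<subseteq> {Z}) \<Longrightarrow> free_forS \<sigma> A"
  by (rule free_forS_if_no_capture[where Y = "{}"]) auto

text \<open>Below a quantifier on x nothing has been renamed, so the fresh y does not occur there;
  every y that is turned back into x stands outside the scope of such quantifiers.\<close>

lemma free_forN_rename_back:
  "y \<notin> fvN A \<union> bvN A \<Longrightarrow> free_forN (NVar(y := NVar x)) (subN (NVar(x := NVar y)) A)"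
proof (induction A)
  case (AllN x' A)
  show ?case
  proof (cases "x' = x")
    case True
    then have "free_forN (NVar(y := NVar x)) A"
      using AllN.prems by (intro free_forN_closed) auto
    moreover have "NVar(x := NVar y, x := NVar x) = NVar"
      and "NVar(y := NVar x, x := NVar x) = NVar(y := NVar x)"
      using True AllN.prems by (auto simp: fun_eq_iff)
    moreover have "\<forall>z \<in> fvN A - {x}. x \<notin> fv_nterm ((NVar(y := NVar x)) z)"
      using AllN.prems by auto
    ultimately show ?thesis using True by (simp del: fun_upd_apply)
  next
    case False
    then have "NVar(x := NVar y, x' := NVar x') = NVar(x := NVar y)"
      and "NVar(y := NVar x, x' := NVar x') = NVar(y := NVar x)"
      using AllN.prems by (auto simp: fun_eq_iff)
    moreover have "\<forall>z. x' \<noteq> z \<longrightarrow> x' \<notin> fv_nterm ((NVar(y := NVar x)) z)"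
      using False by auto
    ultimately show ?thesis using AllN by (auto simp del: fun_upd_apply)
  qed
qed auto

lemma free_forS_rename_back:
  "Y \<notin> fvS A \<union> bvS A \<Longrightarrow> free_forS (SVar(Y := SVar X)) (subS (SVar(X := SVar Y)) A)"
proof (induction A)
  case (AllS X' A)
  show ?case
  proof (cases "X' = X")
    case True
    then have "free_forS (SVar(Y := SVar X)) A"
      using AllS.prems by (intro free_forS_closed) auto
    moreover have "SVar(X := SVar Y, X := SVar X) = SVar"
      and "SVar(Y := SVar X, X := SVar X) = SVar(Y := SVar X)"
      using True AllS.prems by (auto simp: fun_eq_iff)
    moreover have "\<forall>z \<in> fvS A - {X}. X \<notin> fv_sterm ((SVar(Y := SVar X)) z)"
      using AllS.prems by auto
    ultimately show ?thesis using True by (simp del: fun_upd_apply)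
  next
    case False
    then have "SVar(X := SVar Y, X' := SVar X') = SVar(X := SVar Y)"
      and "SVar(Y := SVar X, X' := SVar X') = SVar(Y := SVar X)"
      using AllS.prems by (auto simp: fun_eq_iff)
    moreover have "\<forall>z. X' \<noteq> z \<longrightarrow> X' \<notin> fv_sterm ((SVar(Y := SVar X)) z)"
      using False by auto
    ultimately show ?thesis using AllS by (auto simp del: fun_upd_apply)
  qed
qed auto

lemma subN_rename_back:
  assumes "y \<notin> fvN A \<union> bvN A"
  shows "subN (NVar(y := NVar x)) (subN (NVar(x := NVar y)) A) = A"
proof -
  have "free_forN (NVar(x := NVar y)) A"
    using assms by (intro free_forN_if_no_capture[where Y = "{y}"]) auto
  then have "subN (NVar(y := NVar x)) (subN (NVar(x := NVar y)) A)
      = subN (\<lambda>z. sub_nterm (NVar(y := NVar x)) ((NVar(x := NVar y)) z)) A"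
    by (rule subN_comp)
  also have "\<dots> = subN NVar A" using assms by (intro subN_cong) auto
  finally show ?thesis by simp
qed

lemma subS_rename_back:
  assumes "Y \<notin> fvS A \<union> bvS A"
  shows "subS (SVar(Y := SVar X)) (subS (SVar(X := SVar Y)) A) = A"
proof -
  have "free_forS (SVar(X := SVar Y)) A"
    using assms by (intro free_forS_if_no_capture[where Y = "{Y}"]) auto
  then have "subS (SVar(Y := SVar X)) (subS (SVar(X := SVar Y)) A)
      = subS (\<lambda>Z. sub_sterm (SVar(Y := SVar X)) ((SVar(X := SVar Y)) Z)) A"
    by (rule subS_comp)
  also have "\<dots> = subS SVar A" using assms by (intro subS_cong) auto
  finally show ?thesis by simp
qed

section \<open>Replacing constants by variables\<close>

fun rep_nterm :: "(nat \<Rightarrow> nterm) \<Rightarrow> nterm \<Rightarrow> nterm" where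
  "rep_nterm f (NVar x) = NVar x"
| "rep_nterm f (NCon c) = f c"
| "rep_nterm f Zero = Zero"
| "rep_nterm f One = One"
| "rep_nterm f (Plus s t) = Plus (rep_nterm f s) (rep_nterm f t)"
| "rep_nterm f (Times s t) = Times (rep_nterm f s) (rep_nterm f t)"

fun rep_sterm :: "(nat \<Rightarrow> sterm) \<Rightarrow> sterm \<Rightarrow> sterm" where
  "rep_sterm g (SVar X) = SVar X"
| "rep_sterm g (SCon C) = g C"

fun rep :: "(nat \<Rightarrow> nterm) \<Rightarrow> (nat \<Rightarrow> sterm) \<Rightarrow> fm \<Rightarrow> fm" where
  "rep f g (Eq s t) = Eq (rep_nterm f s) (rep_nterm f t)"
| "rep f g (Less s t) = Less (rep_nterm f s) (rep_nterm f t)"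
| "rep f g (Mem t U) = Mem (rep_nterm f t) (rep_sterm g U)"
| "rep f g (Neg A) = Neg (rep f g A)"
| "rep f g (Imp A B) = Imp (rep f g A) (rep f g B)"
| "rep f g (AllN x A) = AllN x (rep f g A)"
| "rep f g (AllS X A) = AllS X (rep f g A)"

lemma rep_nterm_id: "(\<And>c. c \<in> con_nterm t \<Longrightarrow> f c = NCon c) \<Longrightarrow> rep_nterm f t = t"
  by (induction t) auto

lemma rep_sterm_id: "(\<And>C. C \<in> con_sterm U \<Longrightarrow> g C = SCon C) \<Longrightarrow> rep_sterm g U = U"
  by (cases U) auto

lemma rep_id:
  "(\<And>c. c \<in> conN A \<Longrightarrow> f c = NCon c) \<Longrightarrow> (\<And>C. C \<in> conS A \<Longrightarrow> g C = SCon C) \<Longrightarrow> rep f g A = A"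
  by (induction A) (auto simp: rep_nterm_id rep_sterm_id)

text \<open>Both sorts are treated at once, although each application replaces a single constant of
  one sort, the other map being \<open>NCon\<close> or \<open>SCon\<close>. All new terms share one
  variable per sort, which can be chosen away from a whole proof.\<close>

locale constant_replacement =
  fixes f :: "nat \<Rightarrow> nterm" and g :: "nat \<Rightarrow> sterm" and y Y :: nat
  assumes fv_f: "fv_nterm (f c) \<subseteq> {y}" and fv_g: "fv_sterm (g C) \<subseteq> {Y}"
begin

lemma fv_rep_nterm: "fv_nterm (rep_nterm f t) \<subseteq> insert y (fv_nterm t)"
  using fv_f by (induction t) auto

lemma fv_rep_sterm: "fv_sterm (rep_sterm g U) \<subseteq> insert Y (fv_sterm U)"
  using fv_g by (cases U) auto

lemma fvN_rep: "fvN (rep f g A) \<subseteq> insert y (fvN A)"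
  by (induction A) (auto dest: subsetD[OF fv_rep_nterm])

lemma fvS_rep: "fvS (rep f g A) \<subseteq> insert Y (fvS A)"
  by (induction A) (auto dest: subsetD[OF fv_rep_sterm])

text \<open>The terms \<open>f c\<close> contain at most the variable y, which \<sigma> fixes, so a
  substitution leaves them alone just as it leaves constants alone.\<close>

lemma rep_sub_nterm:
  assumes "\<sigma> y = NVar y"
  shows "rep_nterm f (sub_nterm \<sigma> t) = sub_nterm (\<lambda>z. rep_nterm f (\<sigma> z)) (rep_nterm f t)"
proof (induction t)
  case (NCon c)
  have "sub_nterm (\<lambda>z. rep_nterm f (\<sigma> z)) (f c) = sub_nterm NVar (f c)"
    using fv_f[of c] assms by (intro sub_nterm_cong) auto
  then show ?case by simp
qed auto

lemma rep_sub_sterm: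
  assumes "\<sigma> Y = SVar Y"
  shows "rep_sterm g (sub_sterm \<sigma> U) = sub_sterm (\<lambda>Z. rep_sterm g (\<sigma> Z)) (rep_sterm g U)"
proof (cases U)
  case (SCon C)
  have "sub_sterm (\<lambda>Z. rep_sterm g (\<sigma> Z)) (g C) = sub_sterm SVar (g C)"
    using fv_g[of C] assms by (intro sub_sterm_cong) auto
  then show ?thesis using SCon by simp
qed auto

lemma rep_subN:
  "\<sigma> y = NVar y \<Longrightarrow> rep f g (subN \<sigma> A) = subN (\<lambda>z. rep_nterm f (\<sigma> z)) (rep f g A)"
proof (induction A arbitrary: \<sigma>)
  case (AllN x A)
  have "(\<lambda>z. rep_nterm f ((\<sigma>(x := NVar x)) z)) = (\<lambda>z. rep_nterm f (\<sigma> z))(x := NVar x)"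
    by auto
  moreover have "rep f g (subN (\<sigma>(x := NVar x)) A)
      = subN (\<lambda>z. rep_nterm f ((\<sigma>(x := NVar x)) z)) (rep f g A)"
    using AllN.prems by (intro AllN.IH) auto
  ultimately show ?case by simp
qed (auto simp: rep_sub_nterm)

lemma rep_subS:
  "\<sigma> Y = SVar Y \<Longrightarrow> rep f g (subS \<sigma> A) = subS (\<lambda>Z. rep_sterm g (\<sigma> Z)) (rep f g A)"
proof (induction A arbitrary: \<sigma>)
  case (AllS X A)
  have "(\<lambda>Z. rep_sterm g ((\<sigma>(X := SVar X)) Z)) = (\<lambda>Z. rep_sterm g (\<sigma> Z))(X := SVar X)"
    by auto
  moreover have "rep f g (subS (\<sigma>(X := SVar X)) A)
      = subS (\<lambda>Z. rep_sterm g ((\<sigma>(X := SVar X)) Z)) (rep f g A)"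
    using AllS.prems by (intro AllS.IH) auto
  ultimately show ?case by simp
qed (auto simp: rep_sub_sterm)

text \<open>The replacement adds at most y to the free variables of the formula and of the
  substituted terms. As y is not bound in A, no new capture can arise.\<close>

lemma free_forN_rep:
  "\<sigma> y = NVar y \<Longrightarrow> y \<notin> bvN A \<Longrightarrow> free_forN \<sigma> A \<Longrightarrow>
    free_forN (\<lambda>z. rep_nterm f (\<sigma> z)) (rep f g A)"
proof (induction A arbitrary: \<sigma>)
  case (AllN x A)
  have eq: "(\<lambda>z. rep_nterm f ((\<sigma>(x := NVar x)) z)) = (\<lambda>z. rep_nterm f (\<sigma> z))(x := NVar x)"
    by auto
  have "free_forN (\<lambda>z. rep_nterm f ((\<sigma>(x := NVar x)) z)) (rep f g A)"
    using AllN.prems by (intro AllN.IH) (auto simp del: fun_upd_apply simp: fun_upd_other)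
  moreover have "x \<notin> fv_nterm (rep_nterm f (\<sigma> z))" if "z \<in> fvN (rep f g A) - {x}" for z
  proof (cases "z = y")
    case True
    then show ?thesis using AllN.prems by auto
  next
    case False
    then have "z \<in> fvN A - {x}" using that fvN_rep[of A] by auto
    then show ?thesis using AllN.prems fv_rep_nterm[of "\<sigma> z"] by auto
  qed
  ultimately show ?case using eq by simp
qed auto

lemma free_forS_rep:
  "\<sigma> Y = SVar Y \<Longrightarrow> Y \<notin> bvS A \<Longrightarrow> free_forS \<sigma> A \<Longrightarrow>
    free_forS (\<lambda>Z. rep_sterm g (\<sigma> Z)) (rep f g A)"
proof (induction A arbitrary: \<sigma>)
  case (AllS X A)
  have eq: "(\<lambda>Z. rep_sterm g ((\<sigma>(X := SVar X)) Z)) = (\<lambda>Z. rep_sterm g (\<sigma> Z))(X := SVar X)"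
    by auto
  have "free_forS (\<lambda>Z. rep_sterm g ((\<sigma>(X := SVar X)) Z)) (rep f g A)"
    using AllS.prems by (intro AllS.IH) (auto simp del: fun_upd_apply simp: fun_upd_other)
  moreover have "X \<notin> fv_sterm (rep_sterm g (\<sigma> Z))" if "Z \<in> fvS (rep f g A) - {X}" for Z
  proof (cases "Z = Y")
    case True
    then show ?thesis using AllS.prems by auto
  next
    case False
    then have "Z \<in> fvS A - {X}" using that fvS_rep[of A] by auto
    then show ?thesis using AllS.prems fv_rep_sterm[of "\<sigma> Z"] by auto
  qed
  ultimately show ?case using eq by simp
qed auto

end

text \<open>The provisos of an axiom survive once the new variables avoid finitely many variables of
  the instance; for \<open>DistN\<close>, y must differ from the quantified x. A finite set of
  exceptions is a form that can be combined along a proof by unions.\<close>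

lemma logical_axioms_rep:
  assumes "A \<in> logical_axioms"
  shows "\<exists>F. finite F \<and> (\<forall>y Y f g. y \<notin> F \<longrightarrow> Y \<notin> F \<longrightarrow> constant_replacement f g y Y \<longrightarrow>
    rep f g A \<in> logical_axioms)"
  using assms
proof cases
  case (K A B)
  then show ?thesis by (intro exI[of _ "{}"]) (auto intro: logical_axioms.K)
next
  case (S A B C)
  then show ?thesis by (intro exI[of _ "{}"]) (auto intro: logical_axioms.S)
next
  case (Classical B A)
  then show ?thesis by (intro exI[of _ "{}"]) (auto intro: logical_axioms.Classical)
next
  case (InstN x t B)
  have "rep f g A \<in> logical_axioms"
    if "y \<notin> insert x (bvN B)" and cr: "constant_replacement f g y Y" for y Y f g
  proof -
    interpret constant_replacement f g y Y by (rule cr)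
    let ?\<sigma> = "NVar(x := t)"
    have eq: "(\<lambda>z. rep_nterm f (?\<sigma> z)) = NVar(x := rep_nterm f t)" by auto
    show ?thesis
      using rep_subN[of ?\<sigma> B] free_forN_rep[of ?\<sigma> B] InstN that
      unfolding eq by (auto intro: logical_axioms.InstN)
  qed
  then show ?thesis by (intro exI[of _ "insert x (bvN B)"]) auto
next
  case (InstS X U B)
  have "rep f g A \<in> logical_axioms"
    if "Y \<notin> insert X (bvS B)" and cr: "constant_replacement f g y Y" for y Y f g
  proof -
    interpret constant_replacement f g y Y by (rule cr)
    let ?\<sigma> = "SVar(X := U)"
    have eq: "(\<lambda>z. rep_sterm g (?\<sigma> z)) = SVar(X := rep_sterm g U)" by auto
    show ?thesis
      using rep_subS[of ?\<sigma> B] free_forS_rep[of ?\<sigma> B] InstS that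
      unfolding eq by (auto intro: logical_axioms.InstS)
  qed
  then show ?thesis by (intro exI[of _ "insert X (bvS B)"]) auto
next
  case (DistN x B C)
  have "rep f g A \<in> logical_axioms"
    if "y \<noteq> x" and cr: "constant_replacement f g y Y" for y Y f g
  proof -
    interpret constant_replacement f g y Y by (rule cr)
    show ?thesis using fvN_rep[of B] DistN that by (auto intro!: logical_axioms.DistN)
  qed
  then show ?thesis by (intro exI[of _ "{x}"]) auto
next
  case (DistS X B C)
  have "rep f g A \<in> logical_axioms"
    if "Y \<noteq> X" and cr: "constant_replacement f g y Y" for y Y f g
  proof -
    interpret constant_replacement f g y Y by (rule cr)
    show ?thesis using fvS_rep[of B] DistS that by (auto intro!: logical_axioms.DistS)
  qed
  then show ?thesis by (intro exI[of _ "{X}"]) auto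
next
  case (EqRefl t)
  then show ?thesis by (intro exI[of _ "{}"]) (auto intro: logical_axioms.EqRefl)
next
  case (EqSubst x s B t)
  have "rep f g A \<in> logical_axioms"
    if "y \<notin> insert x (bvN B)" and cr: "constant_replacement f g y Y" for y Y f g
  proof -
    interpret constant_replacement f g y Y by (rule cr)
    have eq: "(\<lambda>z. rep_nterm f ((NVar(x := r)) z)) = NVar(x := rep_nterm f r)" for r by auto
    show ?thesis
      using rep_subN[of "NVar(x := s)" B] free_forN_rep[of "NVar(x := s)" B]
        rep_subN[of "NVar(x := t)" B] free_forN_rep[of "NVar(x := t)" B] EqSubst that
      unfolding eq by (auto intro!: logical_axioms.EqSubst)
  qed
  then show ?thesis by (intro exI[of _ "insert x (bvN B)"]) auto
qed

section \<open>Provability without Rule C\<close>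

text \<open>Without Rule C no record of witnesses restricts generalization, so the deduction theorem
  and the replacement of constants are plain inductions.\<close>

inductive prov :: "fm set \<Rightarrow> fm \<Rightarrow> bool" for T :: "fm set" where
  Axiom: "A \<in> T \<union> logical_axioms \<Longrightarrow> prov T A"
| MP: "prov T (Imp A B) \<Longrightarrow> prov T A \<Longrightarrow> prov T B"
| GenN: "prov T A \<Longrightarrow> prov T (AllN x A)"
| GenS: "prov T A \<Longrightarrow> prov T (AllS X A)"

lemma prov_logical: "A \<in> logical_axioms \<Longrightarrow> prov T A"
  by (simp add: prov.Axiom)

lemma prov_in: "A \<in> T \<Longrightarrow> prov T A"
  by (simp add: prov.Axiom)

lemma prov_mono: "prov T A \<Longrightarrow> T \<subseteq> T' \<Longrightarrow> prov T' A"
  by (induction rule: prov.induct) (auto intro: prov.intros)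

lemma prov_cut: "prov T' A \<Longrightarrow> (\<And>B. B \<in> T' \<Longrightarrow> prov T B) \<Longrightarrow> prov T A"
  by (induction rule: prov.induct) (auto intro: prov.intros)

lemma prov_Imp_refl: "prov T (Imp A A)"
  using prov.MP[OF prov.MP[OF prov_logical[OF logical_axioms.S] prov_logical[OF logical_axioms.K]]
      prov_logical[OF logical_axioms.K[of A A]]] .

lemma prov_Imp_const: "prov T B \<Longrightarrow> prov T (Imp A B)"
  by (rule prov.MP[OF prov_logical[OF logical_axioms.K]])

lemma prov_Imp_MP: "prov T (Imp A (Imp B C)) \<Longrightarrow> prov T (Imp A B) \<Longrightarrow> prov T (Imp A C)"
  by (rule prov.MP[OF prov.MP[OF prov_logical[OF logical_axioms.S]]])

section \<open>Closed assumptions and proof by contradiction\<close>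

definition closed :: "fm \<Rightarrow> bool" where
  "closed A \<longleftrightarrow> fvN A = {} \<and> fvS A = {}"

lemma closed_simps [simp]:
  "closed (Neg A) \<longleftrightarrow> closed A"
  "closed (Imp A B) \<longleftrightarrow> closed A \<and> closed B"
  by (auto simp: closed_def)

lemma closed_instN:
  assumes "closed (AllN x A)" "fv_nterm t = {}"
  shows "closed (subN (NVar(x := t)) A)"
proof -
  have "(\<Union>z\<in>fvN A. fv_nterm ((NVar(x := t)) z)) = {}"
    using assms by (auto simp: closed_def)
  then show ?thesis
    using assms fvN_subN_le[of "NVar(x := t)" A] by (auto simp: closed_def simp del: fun_upd_apply)
qed

lemma closed_instS:
  assumes "closed (AllS X A)" "fv_sterm U = {}"
  shows "closed (subS (SVar(X := U)) A)"
proof -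
  have "(\<Union>Z\<in>fvS A. fv_sterm ((SVar(X := U)) Z)) = {}"
    using assms by (auto simp: closed_def)
  then show ?thesis
    using assms fvS_subS_le[of "SVar(X := U)" A] by (auto simp: closed_def simp del: fun_upd_apply)
qed

text \<open>A closed assumption satisfies the provisos of \<open>DistN\<close> and
  \<open>DistS\<close> for every variable, so each generalization can be carried below the
  implication.\<close>

lemma deduction_theorem:
  assumes "prov (insert A T) B" "closed A"
  shows "prov T (Imp A B)"
  using assms(1)
proof (induction rule: prov.induct)
  case (Axiom B)
  then show ?case by (auto intro: prov_Imp_refl prov_Imp_const prov.Axiom)
next
  case (MP B C)
  then show ?case by (blast intro: prov_Imp_MP)
next
  case (GenN B x)
  have "Imp (AllN x (Imp A B)) (Imp A (AllN x B)) \<in> logical_axioms"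
    using assms(2) by (auto intro!: logical_axioms.DistN simp: closed_def)
  then show ?case by (blast intro: prov.intros prov_logical GenN.IH)
next
  case (GenS B X)
  have "Imp (AllS X (Imp A B)) (Imp A (AllS X B)) \<in> logical_axioms"
    using assms(2) by (auto intro!: logical_axioms.DistS simp: closed_def)
  then show ?case by (blast intro: prov.intros prov_logical GenS.IH)
qed

definition consistent :: "fm set \<Rightarrow> bool" where
  "consistent T \<longleftrightarrow> (\<nexists>A. prov T A \<and> prov T (Neg A))"

lemma prov_if_inconsistent_Neg:
  assumes "\<not> consistent (insert (Neg A) T)" "closed A"
  shows "prov T A"
proof -
  obtain B where "prov (insert (Neg A) T) B" "prov (insert (Neg A) T) (Neg B)"
    using assms(1) by (auto simp: consistent_def)
  then have "prov T (Imp (Neg A) B)" "prov T (Imp (Neg A) (Neg B))"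
    using assms(2) by (auto intro: deduction_theorem)
  then show ?thesis
    using prov.MP[OF prov.MP[OF prov_logical[OF logical_axioms.Classical]]] by blast
qed

text \<open>The previous lemma, applied to \<open>Neg A\<close>, requires a contradiction from the
  double negation of A. That formula proves A, again by the previous lemma, and so inherits the
  inconsistency of A with T.\<close>

lemma prov_Neg_if_inconsistent:
  assumes "\<not> consistent (insert A T)" "closed A"
  shows "prov T (Neg A)"
proof (rule prov_if_inconsistent_Neg)
  let ?T = "insert (Neg (Neg A)) T"
  have "prov ?T A"
  proof (rule prov_if_inconsistent_Neg)
    show "\<not> consistent (insert (Neg A) ?T)"
      by (auto simp: consistent_def intro!: exI[of _ "Neg A"] intro: prov_in)
  qed (use assms in simp)
  then have "prov ?T B" if "prov (insert A T) B" for B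
    using that by (rule_tac prov_cut) (auto intro: prov_in)
  then show "\<not> consistent ?T"
    using assms(1) unfolding consistent_def by blast
qed (use assms in simp)

lemma prov_of_contradiction:
  assumes "prov T A" "prov T (Neg A)"
  shows "prov T B"
  using prov.MP[OF prov.MP[OF prov_logical[OF logical_axioms.Classical] prov_Imp_const[OF assms(2)]]
      prov_Imp_const[OF assms(1)]] .

lemma prov_instN: "prov T (AllN x A) \<Longrightarrow> free_forN (NVar(x := t)) A \<Longrightarrow> prov T (subN (NVar(x := t)) A)"
  by (rule prov.MP[OF prov_logical[OF logical_axioms.InstN]])

lemma prov_instS: "prov T (AllS X A) \<Longrightarrow> free_forS (SVar(X := U)) A \<Longrightarrow> prov T (subS (SVar(X := U)) A)"
  by (rule prov.MP[OF prov_logical[OF logical_axioms.InstS]])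

text \<open>A proof is finite, hence all but finitely many variables can replace constants
  throughout it. The exceptional set precedes the choice of f and g, so the variable may be picked
  after the proof is known.\<close>

lemma prov_rep:
  assumes "prov T A"
  shows "\<exists>F. finite F \<and> (\<forall>y Y f g. y \<notin> F \<longrightarrow> Y \<notin> F \<longrightarrow> constant_replacement f g y Y \<longrightarrow>
    (\<forall>B\<in>T. rep f g B = B) \<longrightarrow> prov T (rep f g A))"
  using assms
proof (induction rule: prov.induct)
  case (Axiom A)
  show ?case
  proof (cases "A \<in> T")
    case True
    then show ?thesis by (intro exI[of _ "{}"]) (auto intro: prov_in)
  next
    case False
    then have "A \<in> logical_axioms" using Axiom by blast
    from logical_axioms_rep[OF this] show ?thesis by (meson prov_logical)
  qed
next
  case (MP A B)
  then obtain F1 F2 where F: "finite F1" "finite F2"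
    and 1: "\<And>y Y f g. y \<notin> F1 \<Longrightarrow> Y \<notin> F1 \<Longrightarrow> constant_replacement f g y Y \<Longrightarrow>
      (\<forall>B\<in>T. rep f g B = B) \<Longrightarrow> prov T (rep f g (Imp A B))"
    and 2: "\<And>y Y f g. y \<notin> F2 \<Longrightarrow> Y \<notin> F2 \<Longrightarrow> constant_replacement f g y Y \<Longrightarrow>
      (\<forall>B\<in>T. rep f g B = B) \<Longrightarrow> prov T (rep f g A)"
    by metis
  have "prov T (rep f g B)" if "y \<notin> F1 \<union> F2" "Y \<notin> F1 \<union> F2" "constant_replacement f g y Y"
    "\<forall>B\<in>T. rep f g B = B" for y Y f g
    using 1[of y Y f g] 2[of y Y f g] that by (auto intro: prov.MP)
  then show ?case using F by (intro exI[of _ "F1 \<union> F2"]) blast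
next
  case (GenN A x)
  then show ?case by (metis prov.GenN rep.simps(6))
next
  case (GenS A X)
  then show ?case by (metis prov.GenS rep.simps(7))
qed

text \<open>The theorem on constants: a constant foreign to T behaves like a variable. It is
  replaced by a fresh y in the whole proof; generalizing on y and instantiating by x recovers A
  itself.\<close>

lemma generalization_on_constantN:
  assumes "prov T (subN (NVar(x := NCon c)) A)" "\<forall>B\<in>T. c \<notin> conN B" "c \<notin> conN A"
  shows "prov T (AllN x A)"
proof -
  obtain F where "finite F" and F: "\<And>y Y f g. y \<notin> F \<Longrightarrow> Y \<notin> F \<Longrightarrow> constant_replacement f g y Y \<Longrightarrow>
      (\<forall>B\<in>T. rep f g B = B) \<Longrightarrow> prov T (rep f g (subN (NVar(x := NCon c)) A))"
    using prov_rep[OF assms(1)] by metis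
  then have "finite (insert x (F \<union> fvN A \<union> bvN A))" by simp
  then obtain y where y: "y \<notin> insert x (F \<union> fvN A \<union> bvN A)"
    using ex_new_if_finite[OF infinite_UNIV_nat] by blast
  define f where "f = NCon(c := NVar y)"
  interpret constant_replacement f SCon y y
    by unfold_locales (auto simp: f_def)
  have "rep f SCon B = B" if "c \<notin> conN B" for B
    using that by (intro rep_id) (auto simp: f_def)
  then have "prov T (rep f SCon (subN (NVar(x := NCon c)) A))" and A: "rep f SCon A = A"
    using F[of y y f SCon] y assms(2,3) constant_replacement_axioms by auto
  moreover have "(\<lambda>z. rep_nterm f ((NVar(x := NCon c)) z)) = NVar(x := NVar y)"
    by (auto simp: f_def)
  ultimately have "prov T (subN (NVar(x := NVar y)) A)"
    using rep_subN[of "NVar(x := NCon c)" A] y by auto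
  then have "prov T (subN (NVar(y := NVar x)) (subN (NVar(x := NVar y)) A))"
    by (rule prov_instN[OF prov.GenN]) (use y free_forN_rename_back in auto)
  then show ?thesis using y by (simp add: subN_rename_back prov.GenN del: fun_upd_apply)
qed

lemma generalization_on_constantS:
  assumes "prov T (subS (SVar(X := SCon C)) A)" "\<forall>B\<in>T. C \<notin> conS B" "C \<notin> conS A"
  shows "prov T (AllS X A)"
proof -
  obtain F where "finite F" and F: "\<And>y Y f g. y \<notin> F \<Longrightarrow> Y \<notin> F \<Longrightarrow> constant_replacement f g y Y \<Longrightarrow>
      (\<forall>B\<in>T. rep f g B = B) \<Longrightarrow> prov T (rep f g (subS (SVar(X := SCon C)) A))"
    using prov_rep[OF assms(1)] by metis
  then have "finite (insert X (F \<union> fvS A \<union> bvS A))" by simp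
  then obtain Y where Y: "Y \<notin> insert X (F \<union> fvS A \<union> bvS A)"
    using ex_new_if_finite[OF infinite_UNIV_nat] by blast
  define g where "g = SCon(C := SVar Y)"
  interpret constant_replacement NCon g Y Y
    by unfold_locales (auto simp: g_def)
  have "rep NCon g B = B" if "C \<notin> conS B" for B
    using that by (intro rep_id) (auto simp: g_def)
  then have "prov T (rep NCon g (subS (SVar(X := SCon C)) A))" and A: "rep NCon g A = A"
    using F[of Y Y NCon g] Y assms(2,3) constant_replacement_axioms by auto
  moreover have "(\<lambda>Z. rep_sterm g ((SVar(X := SCon C)) Z)) = SVar(X := SVar Y)"
    by (auto simp: g_def)
  ultimately have "prov T (subS (SVar(X := SVar Y)) A)"
    using rep_subS[of "SVar(X := SCon C)" A] Y by auto
  then have "prov T (subS (SVar(Y := SVar X)) (subS (SVar(X := SVar Y)) A))"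
    by (rule prov_instS[OF prov.GenS]) (use Y free_forS_rename_back in auto)
  then show ?thesis using Y by (simp add: subS_rename_back prov.GenS del: fun_upd_apply)
qed

section \<open>Henkin theories\<close>

text \<open>Finiteness of the constants in use guarantees a fresh witness at every stage, so that
  the language need not be extended in Henkin's construction.\<close>

definition good :: "fm set \<Rightarrow> bool" where
  "good T \<longleftrightarrow> (\<forall>A\<in>T. closed A) \<and> consistent T \<and> finite (\<Union>(conN ` T)) \<and> finite (\<Union>(conS ` T))"

lemma good_insert: "good T \<Longrightarrow> closed A \<Longrightarrow> consistent (insert A T) \<Longrightarrow> good (insert A T)"
  by (auto simp: good_def)

lemma good_insert_Neg:
  assumes "good T" "closed A" "\<not> prov T A"
  shows "good (insert (Neg A) T)"
  using assms good_insert[of T "Neg A"] prov_if_inconsistent_Neg by auto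

lemma good_decide:
  assumes "good T" "closed A"
  shows "good (insert A T) \<or> good (insert (Neg A) T)"
proof (rule disjCI)
  assume "\<not> good (insert (Neg A) T)"
  then have "prov T A" using good_insert_Neg assms by blast
  moreover have "consistent (insert A T)"
    unfolding consistent_def
  proof clarify
    fix B assume "prov (insert A T) B" "prov (insert A T) (Neg B)"
    moreover have "prov T C" if "C \<in> insert A T" for C
      using that \<open>prov T A\<close> by (auto intro: prov_in)
    ultimately have "prov T B" "prov T (Neg B)"
      using prov_cut[of "insert A T"] by blast+
    then show False using assms(1) by (auto simp: good_def consistent_def)
  qed
  ultimately show "good (insert A T)" using assms good_insert by blast
qed

lemma consistent_not_both: "consistent T \<Longrightarrow> A \<in> T \<Longrightarrow> Neg A \<notin> T"
  unfolding consistent_def by (metis prov_in)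

lemma good_witnessN:
  assumes "good T" "Neg (AllN x A) \<in> T"
  shows "\<exists>c. good (insert (Neg (subN (NVar(x := NCon c)) A)) T)"
proof -
  obtain c where c: "c \<notin> \<Union>(conN ` T)"
    using assms(1) ex_new_if_finite[OF infinite_UNIV_nat] unfolding good_def by blast
  have cl: "closed (AllN x A)" using assms by (auto simp: good_def)
  have "\<not> prov T (subN (NVar(x := NCon c)) A)"
  proof
    assume "prov T (subN (NVar(x := NCon c)) A)"
    moreover have "\<forall>B\<in>T. c \<notin> conN B" using c by blast
    moreover from this have "c \<notin> conN A" using assms(2) by fastforce
    ultimately have "prov T (AllN x A)" by (rule generalization_on_constantN)
    then show False using assms prov_in unfolding good_def consistent_def by blast
  qed
  then have "good (insert (Neg (subN (NVar(x := NCon c)) A)) T)"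
    by (intro good_insert_Neg[OF assms(1)] closed_instN[OF cl]) auto
  then show ?thesis by blast
qed

lemma good_witnessS:
  assumes "good T" "Neg (AllS X A) \<in> T"
  shows "\<exists>C. good (insert (Neg (subS (SVar(X := SCon C)) A)) T)"
proof -
  obtain C where C: "C \<notin> \<Union>(conS ` T)"
    using assms(1) ex_new_if_finite[OF infinite_UNIV_nat] unfolding good_def by blast
  have cl: "closed (AllS X A)" using assms by (auto simp: good_def)
  have "\<not> prov T (subS (SVar(X := SCon C)) A)"
  proof
    assume "prov T (subS (SVar(X := SCon C)) A)"
    moreover have "\<forall>B\<in>T. C \<notin> conS B" using C by blast
    moreover from this have "C \<notin> conS A" using assms(2) by fastforce
    ultimately have "prov T (AllS X A)" by (rule generalization_on_constantS)
    then show False using assms prov_in unfolding good_def consistent_def by blast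
  qed
  then have "good (insert (Neg (subS (SVar(X := SCon C)) A)) T)"
    by (intro good_insert_Neg[OF assms(1)] closed_instS[OF cl]) auto
  then show ?thesis by blast
qed

text \<open>Completeness at A and the Henkin property at A in one condition. Existential formulas
  appear as negated universal ones, so a witness is a constant that refutes the matrix.\<close>

definition decides :: "fm \<Rightarrow> fm set \<Rightarrow> bool" where
  "decides A T \<longleftrightarrow> (closed A \<longrightarrow> A \<in> T \<or> Neg A \<in> T) \<and>
    (\<forall>x B. A = Neg (AllN x B) \<longrightarrow> A \<in> T \<longrightarrow> (\<exists>c. Neg (subN (NVar(x := NCon c)) B) \<in> T)) \<and>
    (\<forall>X B. A = Neg (AllS X B) \<longrightarrow> A \<in> T \<longrightarrow> (\<exists>C. Neg (subS (SVar(X := SCon C)) B) \<in> T))"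

text \<open>If \<open>Neg A\<close> is added, consistency keeps A out and nothing is to be
  witnessed. If A is added and is a negated universal formula, a refuting instance with a fresh
  constant is added together with it.\<close>

lemma good_extend:
  assumes "good T"
  shows "\<exists>T'. T \<subseteq> T' \<and> good T' \<and> decides A T'"
proof -
  consider "\<not> closed A" | "closed A" "good (insert (Neg A) T)" | "closed A" "good (insert A T)"
    using good_decide[OF assms] by blast
  then show ?thesis
  proof cases
    case 1
    then have "A \<notin> T" using assms by (auto simp: good_def)
    then show ?thesis using 1 assms by (auto simp: decides_def)
  next
    case 2
    then have "A \<notin> insert (Neg A) T"
      using consistent_not_both[of "insert (Neg A) T" A] by (auto simp: good_def)
    then have "decides A (insert (Neg A) T)" by (auto simp: decides_def)
    then show ?thesis using 2 by blast
  next
    case 3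
    consider x B where "A = Neg (AllN x B)" | X B where "A = Neg (AllS X B)"
      | "\<nexists>x B. A = Neg (AllN x B)" "\<nexists>X B. A = Neg (AllS X B)" by blast
    then show ?thesis
    proof cases
      case (1 x B)
      then obtain c where "good (insert (Neg (subN (NVar(x := NCon c)) B)) (insert A T))"
        using good_witnessN[OF 3(2)] by auto
      moreover have "decides A (insert (Neg (subN (NVar(x := NCon c)) B)) (insert A T))"
        using 1 unfolding decides_def by auto
      ultimately show ?thesis
        by (intro exI[of _ "insert (Neg (subN (NVar(x := NCon c)) B)) (insert A T)"]) auto
    next
      case (2 X B)
      then obtain C where "good (insert (Neg (subS (SVar(X := SCon C)) B)) (insert A T))"
        using good_witnessS[OF 3(2)] by auto
      moreover have "decides A (insert (Neg (subS (SVar(X := SCon C)) B)) (insert A T))"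
        using 2 unfolding decides_def by auto
      ultimately show ?thesis
        by (intro exI[of _ "insert (Neg (subS (SVar(X := SCon C)) B)) (insert A T)"]) auto
    next
      case 3
      then have "decides A (insert A T)" unfolding decides_def by auto
      then show ?thesis using \<open>good (insert A T)\<close> by blast
    qed
  qed
qed

text \<open>The danger is that A enters later without a witness. But if A is in T', then its
  negation is not, so A was already chosen when T decided.\<close>

lemma decides_mono:
  assumes "decides A T" "T \<subseteq> T'" "consistent T'" "\<And>B. B \<in> T' \<Longrightarrow> closed B"
  shows "decides A T'"
proof (cases "A \<in> T'")
  case True
  then have "Neg A \<notin> T'" "closed A"
    using assms consistent_not_both by blast+
  then have "A \<in> T" using assms unfolding decides_def by blast
  then show ?thesis using assms unfolding decides_def by blast
next
  case False
  then show ?thesis using assms unfolding decides_def by blast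
qed

text \<open>Compactness: a proof uses finitely many members of the union, and by monotonicity some
  stage contains them all.\<close>

lemma prov_Union_chain:
  assumes "prov (\<Union>n. H n) A" "\<And>n. H n \<subseteq> H (Suc n)"
  shows "\<exists>n::nat. prov (H n) A"
  using assms(1)
proof (induction rule: prov.induct)
  case (MP A B)
  then obtain m n where "prov (H m) (Imp A B)" "prov (H n) A" by blast
  moreover have "H m \<subseteq> H (max m n)" "H n \<subseteq> H (max m n)"
    using lift_Suc_mono_le[of H, OF assms(2)] by auto
  ultimately show ?case by (blast intro: prov.MP prov_mono)
qed (auto intro: prov.intros)

instance nterm :: countable by countable_datatype
instance sterm :: countable by countable_datatype
instance fm :: countable by countable_datatype

locale henkin_theory =
  fixes H :: "fm set"
  assumes closed: "A \<in> H \<Longrightarrow> closed A"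
    and consistent: "consistent H"
    and decides: "decides A H"

lemma henkin_extension:
  assumes "good T"
  shows "\<exists>H. T \<subseteq> H \<and> henkin_theory H"
proof -
  have ext: "\<exists>G'. good G' \<and> G \<subseteq> G' \<and> decides A G'" if "good G" for G A
    using good_extend[OF that] by blast
  \<comment> \<open>\<open>from_nat\<close> enumerates all formulas, and stage n settles the n-th
    one; the clause for n = 0 fixes the start of the sequence at T.\<close>
  have "\<exists>G. \<forall>n. (good (G n) \<and> (n = 0 \<longrightarrow> G n = T)) \<and> G n \<subseteq> G (Suc n) \<and> decides (from_nat n) (G (Suc n))"
    using assms
    by (intro dependent_nat_choice[where P = "\<lambda>n G. good G \<and> (n = 0 \<longrightarrow> G = T)"
        and Q = "\<lambda>n G G'. G \<subseteq> G' \<and> decides (from_nat n) G'"]) (auto intro: ext)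
  then obtain G where G: "\<And>n. good (G n)" "G 0 = T" "\<And>n. G n \<subseteq> G (Suc n)"
    "\<And>n. decides (from_nat n) (G (Suc n))" by metis
  let ?H = "\<Union>n. G n"
  have cl: "closed A" if "A \<in> ?H" for A using that G(1) by (auto simp: good_def)
  have mono: "G m \<subseteq> G n" if "m \<le> n" for m n
    using lift_Suc_mono_le[of G, OF G(3)] that by blast
  have con: "consistent ?H"
    unfolding consistent_def
  proof clarify
    fix A assume "prov ?H A" "prov ?H (Neg A)"
    then obtain m n where "prov (G m) A" "prov (G n) (Neg A)"
      using prov_Union_chain[of G, OF _ G(3)] by blast
    then have "prov (G (max m n)) A" "prov (G (max m n)) (Neg A)"
      using prov_mono[OF _ mono] by (meson max.cobounded1 max.cobounded2)+
    then show False using G(1) by (auto simp: good_def consistent_def)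
  qed
  have "decides A ?H" for A
  proof -
    have "decides A (G (Suc (to_nat A)))" using G(4)[of "to_nat A"] by simp
    then show ?thesis using con cl by (rule_tac decides_mono) auto
  qed
  then have "henkin_theory ?H" using cl con by unfold_locales
  then show ?thesis using G(2) by blast
qed

section \<open>Structures and completeness\<close>

text \<open>Henkin semantics: the second sort is an arbitrary domain with a membership relation.
  Extensionality is not imposed, in accordance with the absence of set equality from the
  language.\<close>

record ('n, 's) interp =
  zero_of :: 'n
  one_of :: 'n
  plus_of :: "'n \<Rightarrow> 'n \<Rightarrow> 'n"
  times_of :: "'n \<Rightarrow> 'n \<Rightarrow> 'n"
  less_of :: "'n \<Rightarrow> 'n \<Rightarrow> bool"
  mem_of :: "'n \<Rightarrow> 's \<Rightarrow> bool"

text \<open>Constants get junk values: only formulas without constants are ever interpreted.\<close>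

fun eval :: "('n, 's) interp \<Rightarrow> (nat \<Rightarrow> 'n) \<Rightarrow> nterm \<Rightarrow> 'n" where
  "eval M e (NVar x) = e x"
| "eval M e (NCon c) = zero_of M"
| "eval M e Zero = zero_of M"
| "eval M e One = one_of M"
| "eval M e (Plus s t) = plus_of M (eval M e s) (eval M e t)"
| "eval M e (Times s t) = times_of M (eval M e s) (eval M e t)"

fun seval :: "(nat \<Rightarrow> 's) \<Rightarrow> sterm \<Rightarrow> 's" where
  "seval s (SVar X) = s X"
| "seval s (SCon C) = s 0"

fun sat :: "('n, 's) interp \<Rightarrow> (nat \<Rightarrow> 'n) \<Rightarrow> (nat \<Rightarrow> 's) \<Rightarrow> fm \<Rightarrow> bool" where
  "sat M e s (Eq t u) \<longleftrightarrow> eval M e t = eval M e u"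
| "sat M e s (Less t u) \<longleftrightarrow> less_of M (eval M e t) (eval M e u)"
| "sat M e s (Mem t U) \<longleftrightarrow> mem_of M (eval M e t) (seval s U)"
| "sat M e s (Neg A) \<longleftrightarrow> \<not> sat M e s A"
| "sat M e s (Imp A B) \<longleftrightarrow> (sat M e s A \<longrightarrow> sat M e s B)"
| "sat M e s (AllN x A) \<longleftrightarrow> (\<forall>n. sat M (e(x := n)) s A)"
| "sat M e s (AllS X A) \<longleftrightarrow> (\<forall>S. sat M e (s(X := S)) A)"

lemma sub_nterm_closed: "fv_nterm t = {} \<Longrightarrow> sub_nterm \<sigma> t = t"
  using sub_nterm_cong[of t \<sigma> NVar] by simp

lemma closed_subS_subN:
  assumes "\<And>z. fv_nterm (\<sigma> z) = {}" "\<And>Z. fv_sterm (\<tau> Z) = {}"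
  shows "closed (subS \<tau> (subN \<sigma> A))"
  using assms fvN_subN_le[of \<sigma> A] fvS_subS_le[of \<tau> "subN \<sigma> A"] by (auto simp: closed_def)

context henkin_theory
begin

lemma mem_if_prov: "prov H A \<Longrightarrow> closed A \<Longrightarrow> A \<in> H"
  using decides[of A] consistent prov_in unfolding decides_def consistent_def by blast

lemma Neg_mem: "closed A \<Longrightarrow> Neg A \<in> H \<longleftrightarrow> A \<notin> H"
  using decides[of A] consistent_not_both[OF consistent] unfolding decides_def by blast

lemma Imp_mem:
  assumes "closed A" "closed B"
  shows "Imp A B \<in> H \<longleftrightarrow> (A \<in> H \<longrightarrow> B \<in> H)"
proof
  assume "Imp A B \<in> H"
  then show "A \<in> H \<longrightarrow> B \<in> H" using assms mem_if_prov[OF prov.MP[OF prov_in prov_in]] by blast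
next
  assume R: "A \<in> H \<longrightarrow> B \<in> H"
  have "prov H (Imp A B)"
  proof (cases "B \<in> H")
    case True
    then show ?thesis by (intro prov_Imp_const prov_in)
  next
    case False
    then have "Neg A \<in> H" using R Neg_mem assms by blast
    then have "prov (insert A H) B" by (rule_tac prov_of_contradiction[of _ A]) (auto intro: prov_in)
    then show ?thesis using assms by (intro deduction_theorem)
  qed
  then show "Imp A B \<in> H" using assms by (intro mem_if_prov) auto
qed

lemma AllN_mem:
  assumes "closed (AllN x A)"
  shows "AllN x A \<in> H \<longleftrightarrow> (\<forall>t. fv_nterm t = {} \<longrightarrow> subN (NVar(x := t)) A \<in> H)"
proof
  assume "AllN x A \<in> H"
  show "\<forall>t. fv_nterm t = {} \<longrightarrow> subN (NVar(x := t)) A \<in> H"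
  proof (intro allI impI mem_if_prov)
    fix t assume t: "fv_nterm t = {}"
    then show "prov H (subN (NVar(x := t)) A)"
      using \<open>AllN x A \<in> H\<close> by (intro prov_instN prov_in free_forN_closed) auto
    show "closed (subN (NVar(x := t)) A)" using assms t by (rule closed_instN)
  qed
next
  assume R: "\<forall>t. fv_nterm t = {} \<longrightarrow> subN (NVar(x := t)) A \<in> H"
  show "AllN x A \<in> H"
  proof (rule ccontr)
    assume "AllN x A \<notin> H"
    then have "Neg (AllN x A) \<in> H" using Neg_mem assms by blast
    then obtain c where "Neg (subN (NVar(x := NCon c)) A) \<in> H"
      using decides[of "Neg (AllN x A)"] unfolding decides_def by blast
    moreover have "subN (NVar(x := NCon c)) A \<in> H" using R by simp
    ultimately show False using consistent_not_both[OF consistent] by blast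
  qed
qed

lemma AllS_mem:
  assumes "closed (AllS X A)"
  shows "AllS X A \<in> H \<longleftrightarrow> (\<forall>C. subS (SVar(X := SCon C)) A \<in> H)"
proof
  assume "AllS X A \<in> H"
  show "\<forall>C. subS (SVar(X := SCon C)) A \<in> H"
  proof (intro allI mem_if_prov)
    fix C
    show "prov H (subS (SVar(X := SCon C)) A)"
      using \<open>AllS X A \<in> H\<close> by (intro prov_instS prov_in free_forS_closed) auto
    show "closed (subS (SVar(X := SCon C)) A)" using assms by (rule closed_instS) simp
  qed
next
  assume R: "\<forall>C. subS (SVar(X := SCon C)) A \<in> H"
  show "AllS X A \<in> H"
  proof (rule ccontr)
    assume "AllS X A \<notin> H"
    then have "Neg (AllS X A) \<in> H" using Neg_mem assms by blast
    then obtain C where "Neg (subS (SVar(X := SCon C)) A) \<in> H"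
      using decides[of "Neg (AllS X A)"] unfolding decides_def by blast
    then show False using R consistent_not_both[OF consistent] by blast
  qed
qed

section \<open>Equality in a Henkin theory\<close>

lemma Eq_refl: "fv_nterm t = {} \<Longrightarrow> Eq t t \<in> H"
  by (intro mem_if_prov prov_logical logical_axioms.EqRefl) (simp add: closed_def)

lemma Eq_subst:
  assumes "Eq s t \<in> H" "closed (AllN x A)" "subN (NVar(x := s)) A \<in> H"
  shows "subN (NVar(x := t)) A \<in> H"
proof -
  have st: "fv_nterm s = {}" "fv_nterm t = {}" using closed[OF assms(1)] by (auto simp: closed_def)
  have "prov H (Imp (Eq s t) (Imp (subN (NVar(x := s)) A) (subN (NVar(x := t)) A)))"
    using st by (intro prov_logical logical_axioms.EqSubst free_forN_closed) auto
  then have "prov H (subN (NVar(x := t)) A)"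
    using prov.MP[OF prov.MP] assms(1,3) prov_in by metis
  then show ?thesis using closed_instN[OF assms(2) st(2)] mem_if_prov by blast
qed

lemma Eq_closed: "Eq s t \<in> H \<Longrightarrow> fv_nterm s = {} \<and> fv_nterm t = {}"
  using closed by (fastforce simp: closed_def)

text \<open>Variable 0 marks the place at which the substitution axiom acts; the remaining terms are
  closed and are left unchanged by it. The congruence rules below follow the same pattern.\<close>

lemma Eq_sym: "Eq s t \<in> H \<Longrightarrow> Eq t s \<in> H"
  using Eq_subst[of s t 0 "Eq (NVar 0) s"] Eq_closed[of s t] Eq_refl[of s]
  by (simp add: closed_def sub_nterm_closed)

lemma Eq_trans: "Eq s t \<in> H \<Longrightarrow> Eq t u \<in> H \<Longrightarrow> Eq s u \<in> H"
  using Eq_subst[of t u 0 "Eq s (NVar 0)"] Eq_closed[of s t]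
  by (simp add: closed_def sub_nterm_closed)

lemma Eq_Plus: "Eq s s' \<in> H \<Longrightarrow> Eq t t' \<in> H \<Longrightarrow> Eq (Plus s t) (Plus s' t') \<in> H"
  using Eq_subst[of s s' 0 "Eq (Plus s t) (Plus (NVar 0) t)"]
    Eq_subst[of t t' 0 "Eq (Plus s t) (Plus s' (NVar 0))"]
    Eq_closed[of s s'] Eq_closed[of t t'] Eq_refl[of "Plus s t"]
  by (simp add: closed_def sub_nterm_closed)

lemma Eq_Times: "Eq s s' \<in> H \<Longrightarrow> Eq t t' \<in> H \<Longrightarrow> Eq (Times s t) (Times s' t') \<in> H"
  using Eq_subst[of s s' 0 "Eq (Times s t) (Times (NVar 0) t)"]
    Eq_subst[of t t' 0 "Eq (Times s t) (Times s' (NVar 0))"]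
    Eq_closed[of s s'] Eq_closed[of t t'] Eq_refl[of "Times s t"]
  by (simp add: closed_def sub_nterm_closed)

lemma Less_subst: "Eq s s' \<in> H \<Longrightarrow> Eq t t' \<in> H \<Longrightarrow> Less s t \<in> H \<Longrightarrow> Less s' t' \<in> H"
  using Eq_subst[of s s' 0 "Less (NVar 0) t"] Eq_subst[of t t' 0 "Less s' (NVar 0)"]
    Eq_closed[of s s'] Eq_closed[of t t']
  by (simp add: closed_def sub_nterm_closed)

lemma Mem_subst: "Eq s t \<in> H \<Longrightarrow> Mem s (SCon C) \<in> H \<Longrightarrow> Mem t (SCon C) \<in> H"
  using Eq_subst[of s t 0 "Mem (NVar 0) (SCon C)"] by (simp add: closed_def)

text \<open>The closed term t itself refutes the statement that nothing equals t, so the Henkin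
  property supplies a constant equal to t. Classes of terms can thus be recorded by the constants
  they contain.\<close>

lemma ex_constant:
  assumes "fv_nterm t = {}"
  shows "\<exists>c. Eq t (NCon c) \<in> H"
proof -
  let ?A = "Neg (Eq t (NVar 0))"
  have cl: "closed (AllN 0 ?A)" using assms by (simp add: closed_def)
  have "subN (NVar(0 := t)) ?A \<notin> H"
    using Eq_refl[OF assms] consistent_not_both[OF consistent] assms by (simp add: sub_nterm_closed)
  then have "AllN 0 ?A \<notin> H" using AllN_mem[OF cl] assms by blast
  then have "Neg (AllN 0 ?A) \<in> H" using Neg_mem[OF cl] by simp
  then obtain c where "Neg (subN (NVar(0 := NCon c)) ?A) \<in> H"
    using decides[of "Neg (AllN 0 ?A)"] unfolding decides_def by blast
  then have "Neg (Neg (Eq t (NCon c))) \<in> H" using assms by (simp add: sub_nterm_closed)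
  then show ?thesis using assms Neg_mem[of "Neg (Eq t (NCon c))"] Neg_mem[of "Eq t (NCon c)"]
    by (auto simp: closed_def)
qed

definition eqclass :: "nterm \<Rightarrow> nat set" where
  "eqclass t = {c. Eq t (NCon c) \<in> H}"

lemma eqclass_eq_iff:
  assumes "fv_nterm s = {}" "fv_nterm t = {}"
  shows "eqclass s = eqclass t \<longleftrightarrow> Eq s t \<in> H"
proof
  assume eq: "eqclass s = eqclass t"
  obtain c where c: "Eq s (NCon c) \<in> H" using ex_constant assms by blast
  then have "Eq t (NCon c) \<in> H" using eq unfolding eqclass_def by blast
  then show "Eq s t \<in> H" using c Eq_trans Eq_sym by blast
next
  assume "Eq s t \<in> H"
  then show "eqclass s = eqclass t" unfolding eqclass_def using Eq_trans Eq_sym by blast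
qed

definition dom :: "nat set set" where
  "dom = eqclass ` {t. fv_nterm t = {}}"

text \<open>The quotient of the closed terms, transported to the natural numbers by an enumeration
  of its classes.\<close>

definition val :: "nterm \<Rightarrow> nat" where
  "val t = to_nat_on dom (eqclass t)"

definition term_of :: "nat \<Rightarrow> nterm" where
  "term_of k = (SOME t. fv_nterm t = {} \<and> val t = k)"

definition model :: "(nat, nat) interp" where
  "model = \<lparr>zero_of = val Zero, one_of = val One,
     plus_of = (\<lambda>m n. val (Plus (term_of m) (term_of n))),
     times_of = (\<lambda>m n. val (Times (term_of m) (term_of n))),
     less_of = (\<lambda>m n. Less (term_of m) (term_of n) \<in> H),
     mem_of = (\<lambda>m C. Mem (term_of m) (SCon C) \<in> H)\<rparr>"

end

lemma num_closed [simp]: "fv_nterm (num n) = {}" "con_nterm (num n) = {}"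
  by (induction n) auto

text \<open>Infinitely many distinct numerals make the domain of equivalence classes countably infinite, so
  that it can be identified with the whole type \<^typ>\<open>nat\<close>.\<close>

locale infinite_henkin_theory = henkin_theory +
  assumes num_distinct: "j < i \<Longrightarrow> Neg (Eq (num i) (num j)) \<in> H"
begin

lemma infinite_dom: "infinite dom"
proof
  assume "finite dom"
  then have "finite (range (\<lambda>i. eqclass (num i)))"
    by (rule rev_finite_subset) (auto simp: dom_def)
  moreover have "inj (\<lambda>i. eqclass (num i))"
  proof (rule linorder_injI)
    fix i j :: nat assume "i < j"
    then have "Eq (num j) (num i) \<notin> H"
      using num_distinct consistent_not_both[OF consistent] by blast
    then show "eqclass (num i) \<noteq> eqclass (num j)"
      using eqclass_eq_iff[of "num j" "num i"] by auto
  qed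
  ultimately show False using finite_imageD infinite_UNIV_nat by blast
qed

lemma bij_dom: "bij_betw (to_nat_on dom) dom UNIV"
  using infinite_dom by (intro to_nat_on_infinite) (auto simp: dom_def)

lemma val_eq_iff: "fv_nterm s = {} \<Longrightarrow> fv_nterm t = {} \<Longrightarrow> val s = val t \<longleftrightarrow> Eq s t \<in> H"
  using bij_dom eqclass_eq_iff[of s t]
  by (auto simp: val_def bij_betw_def inj_on_def dom_def)

lemma term_of: "fv_nterm (term_of k) = {} \<and> val (term_of k) = k"
proof -
  have "k \<in> to_nat_on dom ` dom" using bij_dom by (simp add: bij_betw_def)
  then have "\<exists>t. fv_nterm t = {} \<and> val t = k" by (auto simp: dom_def val_def)
  then show ?thesis unfolding term_of_def by (rule someI_ex)
qed

lemma Eq_term_of_val: "fv_nterm t = {} \<Longrightarrow> Eq (term_of (val t)) t \<in> H"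
  using val_eq_iff term_of by blast

lemma Less_term_of_val:
  assumes "fv_nterm s = {}" "fv_nterm t = {}"
  shows "Less (term_of (val s)) (term_of (val t)) \<in> H \<longleftrightarrow> Less s t \<in> H"
  using Eq_term_of_val[OF assms(1)] Eq_term_of_val[OF assms(2)] Less_subst Eq_sym by blast

lemma Mem_term_of_val:
  assumes "fv_nterm t = {}"
  shows "Mem (term_of (val t)) (SCon C) \<in> H \<longleftrightarrow> Mem t (SCon C) \<in> H"
  using Eq_term_of_val[OF assms] Mem_subst Eq_sym by blast

lemma fv_sub_term_of [simp]: "fv_nterm (sub_nterm (\<lambda>x. term_of (e x)) t) = {}"
  using term_of by (simp add: fv_sub_nterm)

lemma eval_model:
  "con_nterm t = {} \<Longrightarrow> eval model e t = val (sub_nterm (\<lambda>x. term_of (e x)) t)"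
proof (induction t)
  case (Plus s t)
  have "Eq (Plus (term_of (val s')) (term_of (val t'))) (Plus s' t') \<in> H"
    if "fv_nterm s' = {}" "fv_nterm t' = {}" for s' t'
    using that by (intro Eq_Plus Eq_term_of_val)
  then show ?case using Plus term_of by (simp add: model_def val_eq_iff)
next
  case (Times s t)
  have "Eq (Times (term_of (val s')) (term_of (val t'))) (Times s' t') \<in> H"
    if "fv_nterm s' = {}" "fv_nterm t' = {}" for s' t'
    using that by (intro Eq_Times Eq_term_of_val)
  then show ?case using Times term_of by (simp add: model_def val_eq_iff)
qed (auto simp: model_def term_of)

text \<open>An assignment acts as a substitution by closed terms: numbers become chosen
  representatives, while the set with index C is the constant \<open>SCon C\<close> itself. No
  quotient is taken on sets, as there is no equality of sets to respect.\<close>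

lemma truth_lemma:
  "conN A = {} \<Longrightarrow> conS A = {} \<Longrightarrow>
    sat model e s A \<longleftrightarrow> subS (\<lambda>X. SCon (s X)) (subN (\<lambda>x. term_of (e x)) A) \<in> H"
proof (induction A arbitrary: e s)
  case (Eq t u)
  then show ?case by (simp add: eval_model val_eq_iff)
next
  case (Less t u)
  then show ?case using Less_term_of_val by (simp add: eval_model) (simp add: model_def)
next
  case (Mem t U)
  then obtain X where "U = SVar X" by (cases U) auto
  then show ?case using Mem Mem_term_of_val by (simp add: eval_model) (simp add: model_def)
next
  case (Neg A)
  have "closed (subS (\<lambda>X. SCon (s X)) (subN (\<lambda>x. term_of (e x)) A))"
    using term_of by (intro closed_subS_subN) auto
  then show ?case using Neg by (simp add: Neg_mem)
next
  case (Imp A B)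
  have "closed (subS (\<lambda>X. SCon (s X)) (subN (\<lambda>x. term_of (e x)) C))" for C
    using term_of by (intro closed_subS_subN) auto
  then show ?case using Imp by (simp add: Imp_mem)
next
  case (AllN x A)
  define \<sigma> where "\<sigma> = (\<lambda>x. term_of (e x))"
  define \<tau> where "\<tau> = (\<lambda>X. SCon (s X))"
  define B where "B = subS \<tau> (subN (\<sigma>(x := NVar x)) A)"
  have sub: "subS \<tau> (subN \<sigma> (AllN x A)) = AllN x B" by (simp add: B_def)
  have cl: "closed (AllN x B)"
    unfolding sub[symmetric] using term_of by (intro closed_subS_subN) (auto simp: \<sigma>_def \<tau>_def)
  have inst: "subN (NVar(x := t)) B = subS \<tau> (subN (\<sigma>(x := t)) A)" for t
  proof -
    have "free_forN (\<sigma>(x := NVar x)) A"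
      using term_of by (intro free_forN_closed) (auto simp: \<sigma>_def)
    then have "subN (NVar(x := t)) (subN (\<sigma>(x := NVar x)) A)
        = subN (\<lambda>z. sub_nterm (NVar(x := t)) ((\<sigma>(x := NVar x)) z)) A"
      by (rule subN_comp)
    also have "\<dots> = subN (\<sigma>(x := t)) A"
      using term_of by (intro subN_cong) (auto simp: sub_nterm_closed \<sigma>_def)
    finally show ?thesis by (simp add: B_def subN_subS_commute)
  qed
  have "(\<lambda>z. term_of ((e(x := k)) z)) = \<sigma>(x := term_of k)" for k by (auto simp: \<sigma>_def)
  then have IH: "sat model (e(x := k)) s A \<longleftrightarrow> subN (NVar(x := term_of k)) B \<in> H" for k
    using AllN.IH[of "e(x := k)" s] AllN.prems inst by (simp add: \<tau>_def del: fun_upd_apply)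
  \<comment> \<open>Every closed term is provably equal to the representative of its value, so the
    instances by representatives already decide all instances.\<close>
  have "(\<forall>k. subN (NVar(x := term_of k)) B \<in> H) \<longleftrightarrow> AllN x B \<in> H"
    unfolding AllN_mem[OF cl] using term_of Eq_subst[OF Eq_term_of_val cl] by blast
  then show ?case using IH sub by (simp add: \<sigma>_def \<tau>_def del: subN.simps subS.simps)
next
  case (AllS X A)
  define \<sigma> where "\<sigma> = (\<lambda>x. term_of (e x))"
  define \<tau> where "\<tau> = (\<lambda>X. SCon (s X))"
  define B where "B = subS (\<tau>(X := SVar X)) (subN \<sigma> A)"
  have sub: "subS \<tau> (subN \<sigma> (AllS X A)) = AllS X B" by (simp add: B_def)
  have cl: "closed (AllS X B)"
    unfolding sub[symmetric] using term_of by (intro closed_subS_subN) (auto simp: \<sigma>_def \<tau>_def)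
  have inst: "subS (SVar(X := SCon C)) B = subS (\<tau>(X := SCon C)) (subN \<sigma> A)" for C
  proof -
    have "free_forS (\<tau>(X := SVar X)) (subN \<sigma> A)"
      by (intro free_forS_closed) (auto simp: \<tau>_def)
    then have "subS (SVar(X := SCon C)) (subS (\<tau>(X := SVar X)) (subN \<sigma> A))
        = subS (\<lambda>Z. sub_sterm (SVar(X := SCon C)) ((\<tau>(X := SVar X)) Z)) (subN \<sigma> A)"
      by (rule subS_comp)
    also have "\<dots> = subS (\<tau>(X := SCon C)) (subN \<sigma> A)"
      by (intro subS_cong) (auto simp: \<tau>_def)
    finally show ?thesis by (simp add: B_def)
  qed
  have "(\<lambda>Z. SCon ((s(X := C)) Z)) = \<tau>(X := SCon C)" for C by (auto simp: \<tau>_def)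
  then have IH: "sat model e (s(X := C)) A \<longleftrightarrow> subS (SVar(X := SCon C)) B \<in> H" for C
    using AllS.IH[of e "s(X := C)"] AllS.prems inst by (simp add: \<sigma>_def del: fun_upd_apply)
  show ?case using IH sub AllS_mem[OF cl] by (simp add: \<sigma>_def \<tau>_def del: subN.simps subS.simps)
qed

end

theorem completeness:
  assumes T: "\<And>B. B \<in> T \<Longrightarrow> sentence B" and P: "sentence P"
    and num_distinct: "\<And>i j. j < i \<Longrightarrow> prov T (Neg (Eq (num i) (num j)))"
    and valid: "\<And>(M :: (nat, nat) interp) e s. (\<And>B e s. B \<in> T \<Longrightarrow> sat M e s B) \<Longrightarrow> sat M e s P"
  shows "prov T P"
proof (rule ccontr)
  assume "\<not> prov T P"
  moreover have "closed P" using P by (simp add: closed_def sentence_def)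
  ultimately have "consistent (insert (Neg P) T)" using prov_if_inconsistent_Neg by blast
  \<comment> \<open>Sentences contain no constants, so even an infinite T leaves all constants free
    to serve as witnesses.\<close>
  then have "good (insert (Neg P) T)"
    using T P by (auto simp: good_def sentence_def closed_def)
  then obtain H where H: "insert (Neg P) T \<subseteq> H" "henkin_theory H"
    using henkin_extension by blast
  interpret henkin_theory H by (rule H(2))
  interpret infinite_henkin_theory H
  proof
    fix i j :: nat assume "j < i"
    then have "prov H (Neg (Eq (num i) (num j)))" using H(1) by (intro prov_mono[OF num_distinct]) auto
    then show "Neg (Eq (num i) (num j)) \<in> H" by (rule mem_if_prov) (simp add: closed_def)
  qed
  have sat: "sat model e s B \<longleftrightarrow> B \<in> H" if "sentence B" for B e s
  proof -
    have "subN \<sigma> B = B" "subS \<tau> B = B" for \<sigma> \<tau>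
      using subN_cong[of B \<sigma> NVar] subS_cong[of B \<tau> SVar] that by (auto simp: sentence_def)
    then show ?thesis using truth_lemma[of B e s] that by (simp add: sentence_def)
  qed
  then have "sat model e s B" if "B \<in> T" for B e s using that T H(1) by blast
  then have "sat model (\<lambda>_. 0) (\<lambda>_. 0) P" by (rule valid)
  then have "P \<in> H" using sat P by blast
  then show False using H(1) consistent_not_both[OF consistent] by blast
qed

text \<open>A proof generalizes on only finitely many set variables \<open>F\<close>, whence a deduction that avoids
  generalizing on a variable chosen outside of \<open>F\<close>.\<close>

lemma ded_of_prov:
  assumes "prov T A"
  shows "\<exists>F. finite F \<and> (\<forall>V G s L. V \<inter> F = {} \<longrightarrow> ded T G V s (L, []) \<longrightarrow>
    (\<exists>L'. set L \<subseteq> set L' \<and> A \<in> set L' \<and> ded T G V s (L', [])))"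
  using assms
proof (induction rule: prov.induct)
  case (Axiom A)
  have "set L \<subseteq> set (A # L) \<and> A \<in> set (A # L) \<and> ded T G V s (A # L, [])"
    if "ded T G V s (L, [])" for V G s L
    using ded.Axiom[OF that Axiom] by auto
  then show ?case by (intro exI[of _ "{}"] conjI allI impI) (rule finite.emptyI, rule exI)
next
  case (MP A B)
  then obtain F1 F2 where F: "finite F1" "finite F2"
    and 1: "\<And>V G s L. V \<inter> F1 = {} \<Longrightarrow> ded T G V s (L, []) \<Longrightarrow>
      \<exists>L'. set L \<subseteq> set L' \<and> Imp A B \<in> set L' \<and> ded T G V s (L', [])"
    and 2: "\<And>V G s L. V \<inter> F2 = {} \<Longrightarrow> ded T G V s (L, []) \<Longrightarrow>
      \<exists>L'. set L \<subseteq> set L' \<and> A \<in> set L' \<and> ded T G V s (L', [])"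
    by metis
  have "\<exists>L'. set L \<subseteq> set L' \<and> B \<in> set L' \<and> ded T G V s (L', [])"
    if V: "V \<inter> (F1 \<union> F2) = {}" and d: "ded T G V s (L, [])" for V G s L
  proof -
    obtain L1 where L1: "set L \<subseteq> set L1" "Imp A B \<in> set L1" "ded T G V s (L1, [])"
      using 1[OF _ d] V by blast
    obtain L2 where L2: "set L1 \<subseteq> set L2" "A \<in> set L2" "ded T G V s (L2, [])"
      using 2[OF _ L1(3)] V by blast
    have "ded T G V s (B # L2, [])" using L1 L2 by (intro ded.MP[of _ _ _ _ _ _ A]) auto
    then show ?thesis using L1 L2 by (intro exI[of _ "B # L2"]) auto
  qed
  then show ?case using F by (intro exI[of _ "F1 \<union> F2"]) blast
next
  case (GenN A x)
  then obtain F where F: "finite F"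
    and 1: "\<And>V G s L. V \<inter> F = {} \<Longrightarrow> ded T G V s (L, []) \<Longrightarrow>
      \<exists>L'. set L \<subseteq> set L' \<and> A \<in> set L' \<and> ded T G V s (L', [])"
    by metis
  have "\<exists>L'. set L \<subseteq> set L' \<and> AllN x A \<in> set L' \<and> ded T G V s (L', [])"
    if V: "V \<inter> F = {}" and d: "ded T G V s (L, [])" for V G s L
  proof -
    obtain L1 where L1: "set L \<subseteq> set L1" "A \<in> set L1" "ded T G V s (L1, [])"
      using 1[OF V d] by blast
    then have "ded T G V s (AllN x A # L1, [])" by (intro ded.GenN) auto
    then show ?thesis using L1 by (intro exI[of _ "AllN x A # L1"]) auto
  qed
  then show ?case using F by blast
next
  case (GenS A X)
  then obtain F where F: "finite F"
    and 1: "\<And>V G s L. V \<inter> F = {} \<Longrightarrow> ded T G V s (L, []) \<Longrightarrow>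
      \<exists>L'. set L \<subseteq> set L' \<and> A \<in> set L' \<and> ded T G V s (L', [])"
    by metis
  have "\<exists>L'. set L \<subseteq> set L' \<and> AllS X A \<in> set L' \<and> ded T G V s (L', [])"
    if V: "V \<inter> insert X F = {}" and d: "ded T G V s (L, [])" for V G s L
  proof -
    obtain L1 where L1: "set L \<subseteq> set L1" "A \<in> set L1" "ded T G V s (L1, [])"
      using 1[OF _ d] V by blast
    then have "ded T G V s (AllS X A # L1, [])" using V by (intro ded.GenS) auto
    then show ?thesis using L1 by (intro exI[of _ "AllS X A # L1"]) auto
  qed
  then show ?case using F by (intro exI[of _ "insert X F"]) blast
qed

section \<open>Universal closures\<close>

lemma fv_foldr_AllN [simp]: "fvN (foldr AllN xs A) = fvN A - set xs" "fvS (foldr AllN xs A) = fvS A"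
  "conN (foldr AllN xs A) = conN A" "conS (foldr AllN xs A) = conS A"
  by (induction xs) auto

lemma fv_foldr_AllS [simp]: "fvS (foldr AllS Xs A) = fvS A - set Xs" "fvN (foldr AllS Xs A) = fvN A"
  "conN (foldr AllS Xs A) = conN A" "conS (foldr AllS Xs A) = conS A"
  by (induction Xs) auto

lemma sat_foldr_AllN: "sat M e s (foldr AllN xs A) \<Longrightarrow> sat M e s A"
proof (induction xs)
  case (Cons x xs)
  then have "sat M (e(x := e x)) s (foldr AllN xs A)" by (auto simp del: fun_upd_triv)
  then show ?case using Cons.IH by simp
qed simp

lemma sat_foldr_AllS: "sat M e s (foldr AllS Xs A) \<Longrightarrow> sat M e s A"
proof (induction Xs)
  case (Cons X Xs)
  then have "sat M e (s(X := s X)) (foldr AllS Xs A)" by (auto simp del: fun_upd_triv)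
  then show ?case using Cons.IH by simp
qed simp

lemma prov_foldr_AllN: "prov T (foldr AllN xs A) \<Longrightarrow> prov T A"
proof (induction xs)
  case (Cons x xs)
  then have "prov T (subN (NVar(x := NVar x)) (foldr AllN xs A))"
    by (intro prov_instN free_forN_closed) auto
  then show ?case using Cons.IH by simp
qed simp

lemma prov_foldr_AllS: "prov T (foldr AllS Xs A) \<Longrightarrow> prov T A"
proof (induction Xs)
  case (Cons X Xs)
  then have "prov T (subS (SVar(X := SVar X)) (foldr AllS Xs A))"
    by (intro prov_instS free_forS_closed) auto
  then show ?case using Cons.IH by simp
qed simp

text \<open>The theory consists of sentences, whereas induction and comprehension are used with
  parameters. Binding all free variables produces a member of the theory from which the open
  instance can be recovered.\<close>

lemma RCA0_closure:
  assumes "A \<in> basic_axioms \<union> Sigma01_induction \<union> Delta01_comprehension" "conN A = {}" "conS A = {}"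
  shows "\<exists>xs Xs. foldr AllN xs (foldr AllS Xs A) \<in> RCA0"
proof -
  obtain xs Xs where "set xs = fvN A" "set Xs = fvS A" by (meson finite_fvN finite_fvS finite_list)
  then have "sentence (foldr AllN xs (foldr AllS Xs A))" using assms by (simp add: sentence_def)
  then show ?thesis using assms(1) unfolding RCA0_def by blast
qed

lemma sentence_RCA0: "B \<in> RCA0 \<Longrightarrow> sentence B"
  by (simp add: RCA0_def)

lemma prov_RCA0:
  assumes "A \<in> basic_axioms" "conN A = {}" "conS A = {}"
  shows "prov RCA0 A"
  using RCA0_closure[of A] assms prov_in prov_foldr_AllN prov_foldr_AllS by blast

text \<open>Cancelling one successor on both sides lowers both numerals until the smaller is zero,
  which no successor equals. The derivation is explicit because completeness presupposes this
  fact.\<close>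

lemma RCA0_num_distinct: "j < i \<Longrightarrow> prov RCA0 (Neg (Eq (num i) (num j)))"
proof (induction j arbitrary: i)
  case 0
  then obtain k where i: "i = Suc k" by (cases i) auto
  have "prov RCA0 (Neg (Eq (succ (NVar 1)) Zero))"
    by (rule prov_RCA0) (auto simp: basic_axioms_def Let_def)
  then have "prov RCA0 (subN (NVar(1 := num k)) (Neg (Eq (succ (NVar 1)) Zero)))"
    by (intro prov_instN prov.GenN free_forN_closed) auto
  then show ?case using i by simp
next
  case (Suc j)
  then obtain k where i: "i = Suc k" "j < k" by (cases i) auto
  let ?A = "Imp (Eq (succ (NVar 0)) (succ (NVar 1))) (Eq (NVar 0) (NVar 1))"
  have "prov RCA0 ?A"
    by (rule prov_RCA0) (auto simp: basic_axioms_def Let_def)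
  then have "prov RCA0 (subN (NVar(0 := num k)) ?A)"
    by (rule prov_instN[OF prov.GenN]) simp
  then have "prov RCA0 (subN (NVar(1 := num j)) (subN (NVar(0 := num k)) ?A))"
    by (rule prov_instN[OF prov.GenN]) simp
  then have imp: "prov RCA0 (Imp (Eq (num i) (num (Suc j))) (Eq (num k) (num j)))"
    using i by (simp add: sub_nterm_closed)
  let ?T = "insert (Eq (num i) (num (Suc j))) RCA0"
  have "prov ?T (Eq (num k) (num j))"
    using prov.MP[OF prov_mono[OF imp] prov_in] by blast
  moreover have "prov ?T (Neg (Eq (num k) (num j)))"
    by (rule prov_mono[OF Suc.IH[OF i(2)]]) blast
  ultimately show ?case
    by (intro prov_Neg_if_inconsistent) (auto simp: consistent_def closed_def)
qed

section \<open>Arithmetic in models of RCA0\<close>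

lemma eval_cong: "(\<And>z. z \<in> fv_nterm t \<Longrightarrow> e z = e' z) \<Longrightarrow> eval M e t = eval M e' t"
  by (induction t) auto

text \<open>Set constants are excluded because they are read as \<open>s 0\<close>, on which the two
  assignments may differ.\<close>

lemma sat_cong:
  "(\<And>z. z \<in> fvN A \<Longrightarrow> e z = e' z) \<Longrightarrow> (\<And>Z. Z \<in> fvS A \<Longrightarrow> s Z = s' Z) \<Longrightarrow> conS A = {} \<Longrightarrow>
    sat M e s A \<longleftrightarrow> sat M e' s' A"
proof (induction A arbitrary: e e' s s')
  case (Eq t u)
  then show ?case using eval_cong[of t e e' M] eval_cong[of u e e' M] by auto
next
  case (Less t u)
  then show ?case using eval_cong[of t e e' M] eval_cong[of u e e' M] by auto
next
  case (Mem t U)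
  then show ?case using eval_cong[of t e e' M] by (cases U) auto
next
  case (Neg A)
  have "sat M e s A \<longleftrightarrow> sat M e' s' A" by (rule Neg.IH) (use Neg.prems in auto)
  then show ?case by simp
next
  case (Imp A B)
  have "sat M e s A \<longleftrightarrow> sat M e' s' A" by (rule Imp.IH) (use Imp.prems in auto)
  moreover have "sat M e s B \<longleftrightarrow> sat M e' s' B" by (rule Imp.IH) (use Imp.prems in auto)
  ultimately show ?case by simp
next
  case (AllN x A)
  have "sat M (e(x := n)) s A \<longleftrightarrow> sat M (e'(x := n)) s' A" for n
    by (rule AllN.IH) (use AllN.prems in auto)
  then show ?case by simp
next
  case (AllS X A)
  have "sat M e (s(X := S)) A \<longleftrightarrow> sat M e' (s'(X := S)) A" for S
    by (rule AllS.IH) (use AllS.prems in auto)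
  then show ?case by simp
qed

lemma sat_Conj: "sat M e s (Conj A B) \<longleftrightarrow> sat M e s A \<and> sat M e s B"
  and sat_Disj: "sat M e s (Disj A B) \<longleftrightarrow> sat M e s A \<or> sat M e s B"
  and sat_Iff: "sat M e s (Iff A B) \<longleftrightarrow> (sat M e s A \<longleftrightarrow> sat M e s B)"
  and sat_ExN: "sat M e s (ExN x A) \<longleftrightarrow> (\<exists>n. sat M (e(x := n)) s A)"
  and sat_ExS: "sat M e s (ExS X A) \<longleftrightarrow> (\<exists>S. sat M e (s(X := S)) A)"
  by auto

lemmas sat_logic = sat_Iff sat_Conj sat_Disj sat_ExN sat_ExS

lemma eval_sub_nterm: "eval M e (sub_nterm \<sigma> t) = eval M (\<lambda>z. eval M e (\<sigma> z)) t"
  by (induction t) auto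

lemma sat_subN:
  "free_forN \<sigma> A \<Longrightarrow> conS A = {} \<Longrightarrow> sat M e s (subN \<sigma> A) \<longleftrightarrow> sat M (\<lambda>z. eval M e (\<sigma> z)) s A"
proof (induction A arbitrary: \<sigma> e s)
  case (AllN x A)
  have "sat M (e(x := n)) s (subN (\<sigma>(x := NVar x)) A) \<longleftrightarrow>
      sat M ((\<lambda>z. eval M e (\<sigma> z))(x := n)) s A" for n
  proof -
    have "sat M (e(x := n)) s (subN (\<sigma>(x := NVar x)) A) \<longleftrightarrow>
        sat M (\<lambda>z. eval M (e(x := n)) ((\<sigma>(x := NVar x)) z)) s A"
      by (rule AllN.IH) (use AllN.prems in \<open>auto simp del: fun_upd_apply\<close>)
    also have "\<dots> \<longleftrightarrow> sat M ((\<lambda>z. eval M e (\<sigma> z))(x := n)) s A"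
      using AllN.prems by (intro sat_cong) (auto intro!: eval_cong)
    finally show ?thesis .
  qed
  then show ?case by simp
qed (auto simp: eval_sub_nterm)

text \<open>The order matters: a bounded existential formula is also a negation, and the rule for
  negations would leave a universal formula of the wrong shape.\<close>

lemmas Sigma00_rules = Sigma00.intros(7,6,5,4,1,2,3)

locale RCA0_model =
  fixes M :: "('n, 's) interp"
  assumes RCA0: "B \<in> RCA0 \<Longrightarrow> sat M e s B"
begin

abbreviation z ("\<zero>") where "\<zero> \<equiv> zero_of M"
abbreviation u ("\<one>") where "\<one> \<equiv> one_of M"
abbreviation add (infixl "\<oplus>" 65) where "a \<oplus> b \<equiv> plus_of M a b"
abbreviation mult (infixl "\<otimes>" 70) where "a \<otimes> b \<equiv> times_of M a b"
abbreviation less (infix "\<prec>" 50) where "a \<prec> b \<equiv> less_of M a b"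
abbreviation mem (infix "\<in>\<^sub>M" 50) where "a \<in>\<^sub>M S \<equiv> mem_of M a S"

lemma sat_axiom:
  assumes "A \<in> basic_axioms \<union> Sigma01_induction \<union> Delta01_comprehension" "conN A = {}" "conS A = {}"
  shows "sat M e s A"
  using RCA0_closure[OF assms] RCA0 sat_foldr_AllN sat_foldr_AllS by blast

lemma succ_neq_zero [simp]: "a \<oplus> \<one> \<noteq> \<zero>"
  using sat_axiom[of "Neg (Eq (succ (NVar 1)) Zero)" "\<lambda>_. a" undefined]
  by (simp add: basic_axioms_def Let_def)

lemma succ_inject [simp]: "a \<oplus> \<one> = b \<oplus> \<one> \<longleftrightarrow> a = b"
  using sat_axiom[of "Imp (Eq (succ (NVar 0)) (succ (NVar 1))) (Eq (NVar 0) (NVar 1))"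
      "(\<lambda>_. a)(1 := b)" undefined]
  by (auto simp: basic_axioms_def Let_def)

lemma add_zero [simp]: "a \<oplus> \<zero> = a"
  using sat_axiom[of "Eq (Plus (NVar 0) Zero) (NVar 0)" "\<lambda>_. a" undefined]
  by (simp add: basic_axioms_def Let_def)

lemma add_succ: "a \<oplus> (b \<oplus> \<one>) = (a \<oplus> b) \<oplus> \<one>"
  using sat_axiom[of "Eq (Plus (NVar 0) (succ (NVar 1))) (succ (Plus (NVar 0) (NVar 1)))"
      "(\<lambda>_. a)(1 := b)" undefined]
  by (simp add: basic_axioms_def Let_def)

lemma mult_zero [simp]: "a \<otimes> \<zero> = \<zero>"
  using sat_axiom[of "Eq (Times (NVar 0) Zero) Zero" "\<lambda>_. a" undefined]
  by (simp add: basic_axioms_def Let_def)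

lemma mult_succ: "a \<otimes> (b \<oplus> \<one>) = a \<otimes> b \<oplus> a"
  using sat_axiom[of "Eq (Times (NVar 0) (succ (NVar 1))) (Plus (Times (NVar 0) (NVar 1)) (NVar 0))"
      "(\<lambda>_. a)(1 := b)" undefined]
  by (simp add: basic_axioms_def Let_def)

lemma not_less_zero [simp]: "\<not> a \<prec> \<zero>"
  using sat_axiom[of "Neg (Less (NVar 0) Zero)" "\<lambda>_. a" undefined]
  by (simp add: basic_axioms_def Let_def)

lemma less_succ: "a \<prec> b \<oplus> \<one> \<longleftrightarrow> a \<prec> b \<or> a = b"
  using sat_axiom[of "Iff (Less (NVar 0) (succ (NVar 1))) (Disj (Less (NVar 0) (NVar 1)) (Eq (NVar 0) (NVar 1)))"
      "(\<lambda>_. a)(1 := b)" undefined]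
  by (auto simp: basic_axioms_def Let_def)

text \<open>Induction as a principle about predicates on the model: e and s hold the parameters of
  B, and variable 0 is the induction variable. A dummy existential quantifier on an x not free in B
  puts the formula into Sigma01 form.\<close>

lemma induction:
  assumes B: "Sigma00 B" "conN B = {}" "conS B = {}"
    and P: "\<And>a. P a \<longleftrightarrow> sat M (e(0 := a)) s B"
    and zero: "P \<zero>" and succ: "\<And>a. P a \<Longrightarrow> P (a \<oplus> \<one>)"
  shows "P a"
proof -
  have "finite (insert 0 (fvN B))" by simp
  then obtain x where x: "x \<notin> insert 0 (fvN B)"
    using ex_new_if_finite[OF infinite_UNIV_nat] by blast
  let ?A = "ExN x B"
  have sat: "sat M e' s ?A \<longleftrightarrow> P (e' 0)" if "\<And>y. y \<noteq> 0 \<Longrightarrow> e' y = e y" for e'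
  proof -
    have "sat M (e'(x := n)) s B \<longleftrightarrow> sat M (e(0 := e' 0)) s B" for n
      using x that B by (intro sat_cong) auto
    then show ?thesis using P by simp
  qed
  have sub: "sat M e' s (subN (NVar(0 := t)) ?A) \<longleftrightarrow> P (eval M e' t)"
    if "\<And>y. y \<noteq> 0 \<Longrightarrow> e' y = e y" "fv_nterm t \<subseteq> {0}" for e' t
  proof -
    have "free_forN (NVar(0 := t)) ?A"
      using that by (intro free_forN_closed) auto
    then have "sat M e' s (subN (NVar(0 := t)) ?A) \<longleftrightarrow> sat M (\<lambda>z. eval M e' ((NVar(0 := t)) z)) s ?A"
      using B by (intro sat_subN) auto
    also have "\<dots> \<longleftrightarrow> P (eval M e' t)"
      using that by (subst sat) auto
    finally show ?thesis .
  qed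
  let ?I = "Imp (Conj (subN (NVar(0 := Zero)) ?A) (AllN 0 (Imp ?A (subN (NVar(0 := succ (NVar 0))) ?A)))) (AllN 0 ?A)"
  have "?I \<in> Sigma01_induction"
    unfolding Sigma01_induction_def Sigma01_def using B(1) by blast
  moreover have "conN ?I = {}" "conS ?I = {}"
    using B conN_subN_le[of "NVar(0 := Zero)" B] conN_subN_le[of "NVar(0 := succ (NVar 0))" B]
      conN_subN_le[of "NVar(0 := Zero, x := NVar x)" B]
      conN_subN_le[of "NVar(0 := succ (NVar 0), x := NVar x)" B] by (auto split: if_splits)
  ultimately have "sat M e s ?I" by (intro sat_axiom) auto
  moreover have "sat M e s (subN (NVar(0 := Zero)) ?A)" using sub[of e Zero] zero by simp
  moreover have "sat M e s (AllN 0 (Imp ?A (subN (NVar(0 := succ (NVar 0))) ?A)))"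
    using sat[of "e(0 := _)"] sub[of "e(0 := _)" "succ (NVar 0)"] succ by simp
  ultimately have "sat M e s (AllN 0 ?A)" unfolding sat_Conj sat.simps(5) by blast
  then have "sat M (e(0 := a)) s ?A" unfolding sat.simps(6) by blast
  then show ?thesis using sat[of "e(0 := a)"] by simp
qed

text \<open>Variable 0 is the element and variable 1 the unbounded quantifier. A and B are the
  matrices of the Sigma01 and the Pi01 form, and both forms being equivalent to P is the Delta01
  condition.\<close>

lemma comprehension:
  assumes AB: "Sigma00 A" "Sigma00 B" "conN A = {}" "conS A = {}" "conN B = {}" "conS B = {}"
    and P: "\<And>n. P n \<longleftrightarrow> (\<exists>w. sat M (e(0 := n, 1 := w)) s A)"
      "\<And>n. P n \<longleftrightarrow> (\<forall>w. sat M (e(0 := n, 1 := w)) s B)"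
  shows "\<exists>S. \<forall>n. n \<in>\<^sub>M S \<longleftrightarrow> P n"
proof -
  obtain X where X: "X \<notin> fvS A"
    using ex_new_if_finite[OF infinite_UNIV_nat finite_fvS] by blast
  let ?C = "Imp (AllN 0 (Iff (ExN 1 A) (AllN 1 B)))
    (ExS X (AllN 0 (Iff (Mem (NVar 0) (SVar X)) (ExN 1 A))))"
  have "?C \<in> Delta01_comprehension"
    unfolding Delta01_comprehension_def Sigma01_def Pi01_def using AB X by force
  then have "sat M e s ?C" using AB by (intro sat_axiom) auto
  moreover have "sat M e' (s(X := S)) A \<longleftrightarrow> sat M e' s A" for e' S
    using AB X by (intro sat_cong) auto
  ultimately have "(\<forall>n. (\<exists>w. sat M (e(0 := n, 1 := w)) s A) \<longleftrightarrow> (\<forall>w. sat M (e(0 := n, 1 := w)) s B)) \<longrightarrow>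
      (\<exists>S. \<forall>n. n \<in>\<^sub>M S \<longleftrightarrow> (\<exists>w. sat M (e(0 := n, 1 := w)) s A))"
    by (simp only: sat_logic sat.simps(3,5,6) eval.simps seval.simps fun_upd_same iff_conv_conj_imp)
  moreover have "\<forall>n. (\<exists>w. sat M (e(0 := n, 1 := w)) s A) \<longleftrightarrow> (\<forall>w. sat M (e(0 := n, 1 := w)) s B)"
    using P by blast
  ultimately show ?thesis unfolding P(1) by blast
qed

section \<open>Semiring laws and cancellation\<close>

lemma add_assoc: "(a \<oplus> b) \<oplus> c = a \<oplus> (b \<oplus> c)"
  by (rule induction[where B = "Eq (Plus (Plus (NVar 1) (NVar 2)) (NVar 0)) (Plus (NVar 1) (Plus (NVar 2) (NVar 0)))"
        and e = "(\<lambda>_. a)(2 := b)" and a = c])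
    (auto intro: Sigma00.intros simp: add_succ)

lemma zero_add [simp]: "\<zero> \<oplus> a = a"
  by (rule induction[where B = "Eq (Plus Zero (NVar 0)) (NVar 0)" and a = a])
    (auto intro: Sigma00.intros simp: add_succ)

lemma succ_add: "(a \<oplus> \<one>) \<oplus> b = (a \<oplus> b) \<oplus> \<one>"
  by (rule induction[where B = "Eq (Plus (succ (NVar 1)) (NVar 0)) (succ (Plus (NVar 1) (NVar 0)))"
        and e = "\<lambda>_. a" and a = b])
    (auto intro: Sigma00.intros simp: add_succ)

lemma add_commute: "a \<oplus> b = b \<oplus> a"
  by (rule induction[where B = "Eq (Plus (NVar 1) (NVar 0)) (Plus (NVar 0) (NVar 1))"
        and e = "\<lambda>_. a" and a = b])
    (auto intro: Sigma00.intros simp: add_succ succ_add)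

lemma add_left_commute: "a \<oplus> (b \<oplus> c) = b \<oplus> (a \<oplus> c)"
  by (metis add_assoc add_commute)

lemmas add_ac = add_assoc add_commute add_left_commute

lemma zero_mult [simp]: "\<zero> \<otimes> a = \<zero>"
  by (rule induction[where B = "Eq (Times Zero (NVar 0)) Zero" and a = a])
    (auto intro: Sigma00.intros simp: mult_succ)

lemma succ_mult: "(a \<oplus> \<one>) \<otimes> b = a \<otimes> b \<oplus> b"
  by (rule induction[where B = "Eq (Times (succ (NVar 1)) (NVar 0)) (Plus (Times (NVar 1) (NVar 0)) (NVar 0))"
        and e = "\<lambda>_. a" and a = b])
    (auto intro: Sigma00.intros simp: mult_succ add_ac)

lemma mult_commute: "a \<otimes> b = b \<otimes> a"
  by (rule induction[where B = "Eq (Times (NVar 1) (NVar 0)) (Times (NVar 0) (NVar 1))"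
        and e = "\<lambda>_. a" and a = b])
    (auto intro: Sigma00.intros simp: mult_succ succ_mult)

lemma distrib_left: "a \<otimes> (b \<oplus> c) = a \<otimes> b \<oplus> a \<otimes> c"
  by (rule induction[where B = "Eq (Times (NVar 1) (Plus (NVar 2) (NVar 0))) (Plus (Times (NVar 1) (NVar 2)) (Times (NVar 1) (NVar 0)))"
        and e = "(\<lambda>_. a)(2 := b)" and a = c])
    (auto intro: Sigma00.intros simp: mult_succ add_assoc[symmetric])

lemma distrib_right: "(b \<oplus> c) \<otimes> a = b \<otimes> a \<oplus> c \<otimes> a"
  using distrib_left by (simp add: mult_commute)

lemma add_right_cancel [simp]: "a \<oplus> c = b \<oplus> c \<longleftrightarrow> a = b"
proof -
  have "a \<oplus> c = b \<oplus> c \<longrightarrow> a = b"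
    by (rule induction[where B = "Imp (Eq (Plus (NVar 1) (NVar 0)) (Plus (NVar 2) (NVar 0))) (Eq (NVar 1) (NVar 2))"
        and e = "(\<lambda>_. a)(2 := b)" and a = c])
      (auto intro: Sigma00.intros simp: add_assoc[symmetric])
  then show ?thesis by blast
qed

lemma add_left_cancel [simp]: "c \<oplus> a = c \<oplus> b \<longleftrightarrow> a = b"
  using add_right_cancel by (simp add: add_commute)

section \<open>The order by differences\<close>

lemma less_self_add_succ: "a \<prec> (a \<oplus> c) \<oplus> \<one>"
  by (rule induction[where B = "Less (NVar 1) (succ (Plus (NVar 1) (NVar 0)))" and e = "\<lambda>_. a" and a = c])
    (auto intro: Sigma00.intros simp: add_assoc[symmetric] less_succ)

lemma zero_or_succ: "a = \<zero> \<or> (\<exists>b. a = b \<oplus> \<one>)"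
proof -
  \<comment> \<open>The predecessor is bounded by a in order to make the induction formula Sigma00;
    the bound is dropped afterwards.\<close>
  have "a = \<zero> \<or> (\<exists>b. b \<prec> a \<and> a = b \<oplus> \<one>)"
    by (rule induction[where B = "Disj (Eq (NVar 0) Zero) (ExN 1 (Conj (Less (NVar 1) (NVar 0)) (Eq (NVar 0) (succ (NVar 1)))))" and a = a])
      ((rule Sigma00_rules)+, auto simp: less_succ)
  then show ?thesis by blast
qed

lemma add_eq_zero: "a \<oplus> b = \<zero> \<Longrightarrow> b = \<zero>"
  using zero_or_succ[of b] by (auto simp: add_assoc[symmetric])

lemma trichotomy: "(\<exists>c. b = (a \<oplus> c) \<oplus> \<one>) \<or> a = b \<or> (\<exists>c. a = (b \<oplus> c) \<oplus> \<one>)"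
proof -
  \<comment> \<open>Bounding each difference by the larger number keeps the formula Sigma00. In the
    induction step the bound is restored by writing the larger number as the difference plus
    something plus one.\<close>
  have "(\<exists>c. c \<prec> b \<and> b = (a \<oplus> c) \<oplus> \<one>) \<or> a = b \<or> (\<exists>c. c \<prec> a \<and> a = (b \<oplus> c) \<oplus> \<one>)"
  proof (rule induction[where e = "\<lambda>_. a" and a = b and B = "Disj
      (ExN 2 (Conj (Less (NVar 2) (NVar 0)) (Eq (NVar 0) (succ (Plus (NVar 1) (NVar 2))))))
      (Disj (Eq (NVar 1) (NVar 0))
      (ExN 2 (Conj (Less (NVar 2) (NVar 1)) (Eq (NVar 1) (succ (Plus (NVar 0) (NVar 2)))))))"])
    show "Sigma00 (Disj
      (ExN 2 (Conj (Less (NVar 2) (NVar 0)) (Eq (NVar 0) (succ (Plus (NVar 1) (NVar 2))))))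
      (Disj (Eq (NVar 1) (NVar 0))
      (ExN 2 (Conj (Less (NVar 2) (NVar 1)) (Eq (NVar 1) (succ (Plus (NVar 0) (NVar 2))))))))"
      by (rule Sigma00_rules | simp)+
    show "(\<exists>c. c \<prec> \<zero> \<and> \<zero> = (a \<oplus> c) \<oplus> \<one>) \<or> a = \<zero> \<or> (\<exists>c. c \<prec> a \<and> a = (\<zero> \<oplus> c) \<oplus> \<one>)"
      using zero_or_succ[of a] less_succ by auto
  next
    fix b
    assume "(\<exists>c. c \<prec> b \<and> b = (a \<oplus> c) \<oplus> \<one>) \<or> a = b \<or> (\<exists>c. c \<prec> a \<and> a = (b \<oplus> c) \<oplus> \<one>)"
    then consider c where "b = (a \<oplus> c) \<oplus> \<one>" | "a = b" | c where "a = (b \<oplus> c) \<oplus> \<one>" by blast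
    then show "(\<exists>c. c \<prec> b \<oplus> \<one> \<and> b \<oplus> \<one> = (a \<oplus> c) \<oplus> \<one>) \<or> a = b \<oplus> \<one>
        \<or> (\<exists>c. c \<prec> a \<and> a = ((b \<oplus> \<one>) \<oplus> c) \<oplus> \<one>)"
    proof cases
      case (1 c)
      have "(c \<oplus> \<one>) \<prec> ((c \<oplus> \<one>) \<oplus> a) \<oplus> \<one>" by (rule less_self_add_succ)
      also have "((c \<oplus> \<one>) \<oplus> a) \<oplus> \<one> = b \<oplus> \<one>" using 1 by (simp add: add_ac)
      finally have "(c \<oplus> \<one>) \<prec> b \<oplus> \<one> \<and> b \<oplus> \<one> = (a \<oplus> (c \<oplus> \<one>)) \<oplus> \<one>"
        using 1 by (simp add: add_ac)
      then show ?thesis by blast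
    next
      case 2
      then have "\<zero> \<prec> b \<oplus> \<one> \<and> b \<oplus> \<one> = (a \<oplus> \<zero>) \<oplus> \<one>"
        using less_self_add_succ[of \<zero> b] by simp
      then show ?thesis by blast
    next
      case (3 c)
      from zero_or_succ[of c] show ?thesis
      proof
        assume "c = \<zero>"
        then show ?thesis using 3 by simp
      next
        assume "\<exists>d. c = d \<oplus> \<one>"
        then obtain d where d: "c = d \<oplus> \<one>" by blast
        have "d \<prec> (d \<oplus> (b \<oplus> \<one>)) \<oplus> \<one>" by (rule less_self_add_succ)
        also have "(d \<oplus> (b \<oplus> \<one>)) \<oplus> \<one> = a" using 3 d by (simp add: add_ac)
        finally have "d \<prec> a \<and> a = ((b \<oplus> \<one>) \<oplus> d) \<oplus> \<one>" using 3 d by (simp add: add_ac)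
        then show ?thesis by blast
      qed
    qed
  qed auto
  then show ?thesis by blast
qed

section \<open>Injectivity of the pairing function and bounds on components\<close>

definition pr :: "'n \<Rightarrow> 'n \<Rightarrow> 'n" where
  "pr a b = (a \<oplus> b) \<otimes> (a \<oplus> b) \<oplus> a"

lemma eval_pair [simp]: "eval M e (pair t t') = pr (eval M e t) (eval M e t')"
  by (simp add: pair_def pr_def)

text \<open>With n = a + b and k = c + 1, the square of n + k exceeds the square of n by more than
  n, whereas a is at most n. The larger square can therefore not be compensated.\<close>

lemma pr_neq_if_less:
  assumes "a' \<oplus> b' = ((a \<oplus> b) \<oplus> c) \<oplus> \<one>"
  shows "pr a b \<noteq> pr a' b'"
proof
  assume eq: "pr a b = pr a' b'"
  define n where "n = a \<oplus> b"
  define k where "k = c \<oplus> \<one>"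
  have "a' \<oplus> b' = n \<oplus> k" using assms by (simp add: n_def k_def add_assoc)
  then have "n \<otimes> n \<oplus> a = (n \<oplus> k) \<otimes> (n \<oplus> k) \<oplus> a'"
    using eq by (simp add: pr_def n_def)
  also have "\<dots> = n \<otimes> n \<oplus> (n \<otimes> k \<oplus> k \<otimes> n \<oplus> k \<otimes> k \<oplus> a')"
    by (simp add: distrib_left distrib_right add_ac)
  finally have "a = n \<otimes> k \<oplus> k \<otimes> n \<oplus> k \<otimes> k \<oplus> a'" by simp
  \<comment> \<open>The summand a comes out of \<open>n \<otimes> k\<close>, since n = a + b and k
    is at least one; the final one comes out of \<open>k \<otimes> k\<close>.\<close>
  also have "\<dots> = a \<oplus> ((b \<oplus> n \<otimes> c \<oplus> k \<otimes> n \<oplus> k \<otimes> c \<oplus> a' \<oplus> c) \<oplus> \<one>)"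
  proof -
    have "n \<otimes> k = a \<oplus> b \<oplus> n \<otimes> c" by (simp add: k_def mult_succ) (simp add: n_def add_ac)
    moreover have "k \<otimes> k = k \<otimes> c \<oplus> c \<oplus> \<one>" by (subst (2) k_def) (simp add: mult_succ, simp add: k_def add_ac)
    ultimately show ?thesis by (simp add: add_ac)
  qed
  finally have "a \<oplus> \<zero> = a \<oplus> ((b \<oplus> n \<otimes> c \<oplus> k \<otimes> n \<oplus> k \<otimes> c \<oplus> a' \<oplus> c) \<oplus> \<one>)" by simp
  then show False by (metis add_left_cancel succ_neq_zero)
qed

text \<open>Trichotomy excludes different sums; with equal sums the squares cancel and leave the
  first components.\<close>

lemma pr_inject [simp]: "pr a b = pr a' b' \<longleftrightarrow> a = a' \<and> b = b'"
proof
  assume eq: "pr a b = pr a' b'"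
  then have sum: "a \<oplus> b = a' \<oplus> b'"
    using trichotomy[of "a' \<oplus> b'" "a \<oplus> b"] pr_neq_if_less[of a' b' a b] pr_neq_if_less[of a b a' b']
    by metis
  then have "a = a'" using eq by (simp add: pr_def)
  then show "a = a' \<and> b = b'" using sum by simp
qed simp

text \<open>A difference can be read off directly from the polynomial \<open>pr\<close>;
  \<open>less_succ_if_le\<close> converts it into the strict bound that bounded quantifiers
  require.\<close>

definition le (infix "\<preceq>" 50) where "a \<preceq> b \<longleftrightarrow> (\<exists>c. b = a \<oplus> c)"

lemma le_trans: "a \<preceq> b \<Longrightarrow> b \<preceq> c \<Longrightarrow> a \<preceq> c"
  by (auto simp: le_def add_assoc)

lemma less_succ_if_le: "a \<preceq> b \<Longrightarrow> a \<prec> b \<oplus> \<one>"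
  using less_self_add_succ by (auto simp: le_def)

lemma le_pr1: "a \<preceq> pr a b"
  by (auto simp: le_def pr_def add_commute)

lemma le_pr2: "b \<preceq> pr a b"
proof -
  consider "a \<oplus> b = \<zero>" | k where "a \<oplus> b = k \<oplus> \<one>" using zero_or_succ by blast
  then show ?thesis
  proof cases
    case 1
    then have "b = \<zero>" by (rule add_eq_zero)
    then show ?thesis by (simp add: le_def)
  next
    case (2 k)
    \<comment> \<open>A positive sum is at most its square, so b can be split off from one copy of
      the sum.\<close>
    have "pr a b = (a \<oplus> b) \<otimes> k \<oplus> (a \<oplus> b) \<oplus> a" unfolding pr_def using 2 by (metis mult_succ)
    also have "\<dots> = b \<oplus> ((a \<oplus> b) \<otimes> k \<oplus> a \<oplus> a)" by (simp add: add_ac)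
    finally show ?thesis unfolding le_def by blast
  qed
qed

end

section \<open>Ramsey's theorem in models of RCA0\<close>

context RCA0_model
begin

primrec nm :: "nat \<Rightarrow> 'n" where
  "nm 0 = \<zero>"
| "nm (Suc n) = nm n \<oplus> \<one>"

lemma eval_num [simp]: "eval M e (num n) = nm n"
  by (induction n) auto

definition is_coloring :: "nat \<Rightarrow> 's \<Rightarrow> bool" where
  "is_coloring k f \<longleftrightarrow>
     (\<forall>x. x \<in>\<^sub>M f \<longrightarrow> (\<exists>a b c. a \<prec> b \<and> c \<prec> nm k \<and> x = pr (pr a b) c)) \<and>
     (\<forall>a b. a \<prec> b \<longrightarrow> (\<exists>c. pr (pr a b) c \<in>\<^sub>M f)) \<and>
     (\<forall>a b c d. pr (pr a b) c \<in>\<^sub>M f \<and> pr (pr a b) d \<in>\<^sub>M f \<longrightarrow> c = d)"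

definition is_function :: "'s \<Rightarrow> bool" where
  "is_function h \<longleftrightarrow>
     (\<forall>x. x \<in>\<^sub>M h \<longrightarrow> (\<exists>a b. x = pr a b)) \<and> (\<forall>a. \<exists>b. pr a b \<in>\<^sub>M h) \<and>
     (\<forall>a b c. pr a b \<in>\<^sub>M h \<and> pr a c \<in>\<^sub>M h \<longrightarrow> b = c)"

definition homogeneous :: "'s \<Rightarrow> 's \<Rightarrow> 'n \<Rightarrow> bool" where
  "homogeneous f h c \<longleftrightarrow> (\<forall>m n a b. m \<prec> n \<and> pr (m \<oplus> \<one>) a \<in>\<^sub>M h \<and> pr (n \<oplus> \<one>) b \<in>\<^sub>M h \<longrightarrow>
     a \<prec> b \<and> pr (pr a b) c \<in>\<^sub>M f)"

definition is_monochromatic :: "nat \<Rightarrow> 's \<Rightarrow> 's \<Rightarrow> bool" where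
  "is_monochromatic k f h \<longleftrightarrow>
     is_function h \<and> (\<exists>c. c \<prec> nm k \<and> pr \<zero> c \<in>\<^sub>M h \<and> homogeneous f h c)"

lemma sat_coloring: "sat M e s (coloring k (SVar F)) \<longleftrightarrow> is_coloring k (s F)"
  unfolding coloring_def Let_def is_coloring_def sat_logic
  by (simp add: sat_logic del: sat.simps(4))

lemma sat_monochromatic:
  "sat M e s (monochromatic k (SVar F) (SVar X)) \<longleftrightarrow> is_monochromatic k (s F) (s X)"
  unfolding monochromatic_def total_function_def Let_def is_monochromatic_def is_function_def
    homogeneous_def sat_logic
  by (simp add: sat_logic del: sat.simps(4))

section \<open>The colors as pairs of binary digits\<close>

lemma less_one: "a \<prec> \<one> \<longleftrightarrow> a = \<zero>"
  using less_succ[of a \<zero>] by simp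

lemma less_nm2: "a \<prec> nm 2 \<longleftrightarrow> a = \<zero> \<or> a = \<one>"
  by (simp add: numeral_2_eq_2 less_succ less_one disj_commute)

lemma less_nm4: "a \<prec> nm 4 \<longleftrightarrow> (\<exists>c d. c \<prec> nm 2 \<and> d \<prec> nm 2 \<and> a = c \<oplus> c \<oplus> d)"
proof -
  have "a \<prec> nm 4 \<longleftrightarrow> a = \<zero> \<or> a = \<one> \<or> a = \<one> \<oplus> \<one> \<or> a = \<one> \<oplus> \<one> \<oplus> \<one>"
    by (simp add: eval_nat_numeral less_succ less_one disj_ac)
  also have "\<dots> \<longleftrightarrow> (\<exists>c d. (c = \<zero> \<or> c = \<one>) \<and> (d = \<zero> \<or> d = \<one>) \<and> a = c \<oplus> c \<oplus> d)"
    by (simp add: conj_disj_distribR ex_disj_distrib disj_ac)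
  finally show ?thesis unfolding less_nm2 .
qed

lemma digits_inject:
  assumes "c \<prec> nm 2" "d \<prec> nm 2" "c' \<prec> nm 2" "d' \<prec> nm 2" "c \<oplus> c \<oplus> d = c' \<oplus> c' \<oplus> d'"
  shows "c = c' \<and> d = d'"
proof -
  have 1: "\<one> \<noteq> \<zero>" using succ_neq_zero[of \<zero>] by simp
  have 2: "\<one> \<oplus> \<one> \<noteq> \<one>" using succ_inject[of \<one> \<zero>] 1 by simp
  have 3: "\<one> \<oplus> \<one> \<oplus> \<one> \<noteq> \<one>" using succ_inject[of "\<one> \<oplus> \<one>" \<zero>] by simp
  show ?thesis
    using assms 1 2 3 1[symmetric] 2[symmetric] 3[symmetric] succ_neq_zero[symmetric]
    unfolding less_nm2 by (elim disjE) simp_all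
qed

lemma pr3_bounds:
  assumes "x = pr (pr a b) c"
  shows "a \<prec> x \<oplus> \<one>" "b \<prec> x \<oplus> \<one>" "c \<prec> x \<oplus> \<one>"
  using assms le_trans[OF le_pr1 le_pr1] le_trans[OF le_pr2 le_pr1] le_pr2 less_succ_if_le by auto

text \<open>A code bounds its components, so quantifiers over them may be bounded by the successor
  of the code. This is what makes the formulas below Sigma00 apart from at most one
  quantifier.\<close>

lemma bounded_ex_pr3:
  assumes "\<And>a b c. Q a b c \<Longrightarrow> x = pr (pr a b) c"
  shows "(\<exists>a. a \<prec> x \<oplus> \<one> \<and> (\<exists>b. b \<prec> x \<oplus> \<one> \<and> (\<exists>c. c \<prec> x \<oplus> \<one> \<and> Q a b c))) \<longleftrightarrow> (\<exists>a b c. Q a b c)"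
  using pr3_bounds[OF assms] by blast

lemma pr2_bounds:
  assumes "x = pr a b"
  shows "a \<prec> x \<oplus> \<one>" "b \<prec> x \<oplus> \<one>"
  using assms le_pr1 le_pr2 less_succ_if_le by auto

lemma bounded_ex_pr2:
  assumes "\<And>a b. Q a b \<Longrightarrow> x = pr a b"
  shows "(\<exists>a. a \<prec> x \<oplus> \<one> \<and> (\<exists>b. b \<prec> x \<oplus> \<one> \<and> Q a b)) \<longleftrightarrow> (\<exists>a b. Q a b)"
  using pr2_bounds[OF assms] by blast

section \<open>Sets obtained from Delta01 comprehension\<close>

abbreviation BEx :: "nat \<Rightarrow> nterm \<Rightarrow> fm \<Rightarrow> fm" where
  "BEx x t A \<equiv> ExN x (Conj (Less (NVar x) t) A)"

abbreviation BAll :: "nat \<Rightarrow> nterm \<Rightarrow> fm \<Rightarrow> fm" where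
  "BAll x t A \<equiv> AllN x (Imp (Less (NVar x) t) A)"

lemma ex_high_bit:
  "\<exists>g. \<forall>x. x \<in>\<^sub>M g \<longleftrightarrow> (\<exists>a b c d. a \<prec> b \<and> c \<prec> nm 2 \<and> d \<prec> nm 2 \<and> x = pr (pr a b) c \<and>
     pr (pr a b) (c \<oplus> c \<oplus> d) \<in>\<^sub>M f)" (is "\<exists>g. \<forall>x. _ \<longleftrightarrow> ?P x")
proof -
  define A where "A = BEx 2 (succ (NVar 0)) (BEx 3 (succ (NVar 0)) (BEx 4 (succ (NVar 0)) (BEx 5 (num 2)
    (Conj (Less (NVar 2) (NVar 3)) (Conj (Less (NVar 4) (num 2))
    (Conj (Eq (NVar 0) (pair (pair (NVar 2) (NVar 3)) (NVar 4)))
      (Mem (pair (pair (NVar 2) (NVar 3)) (Plus (Plus (NVar 4) (NVar 4)) (NVar 5))) (SVar 0))))))))"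
  have "Sigma00 A" unfolding A_def by (rule Sigma00_rules | simp)+
  moreover have "conN A = {}" "conS A = {}" by (simp_all add: A_def pair_def)
  moreover have "sat M (e(0 := x, 1 := w)) (\<lambda>_. f) A \<longleftrightarrow> ?P x" for e x w
  proof -
    have "sat M (e(0 := x, 1 := w)) (\<lambda>_. f) A \<longleftrightarrow> (\<exists>a. a \<prec> x \<oplus> \<one> \<and> (\<exists>b. b \<prec> x \<oplus> \<one> \<and>
      (\<exists>c. c \<prec> x \<oplus> \<one> \<and> (\<exists>d. d \<prec> nm 2 \<and> a \<prec> b \<and> c \<prec> nm 2 \<and> x = pr (pr a b) c \<and>
        pr (pr a b) (c \<oplus> c \<oplus> d) \<in>\<^sub>M f))))"
      unfolding A_def by (simp add: sat_logic del: sat.simps(4))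
    also have "\<dots> \<longleftrightarrow> (\<exists>a b c d. d \<prec> nm 2 \<and> a \<prec> b \<and> c \<prec> nm 2 \<and> x = pr (pr a b) c \<and>
        pr (pr a b) (c \<oplus> c \<oplus> d) \<in>\<^sub>M f)"
      by (rule bounded_ex_pr3) blast
    also have "\<dots> \<longleftrightarrow> ?P x" by blast
    finally show ?thesis .
  qed
  \<comment> \<open>The missing digit d is below 2, so A is Sigma00 and insensitive to variable 1;
    it serves as the matrix of both forms.\<close>
  ultimately show ?thesis by (intro comprehension[where A = A and B = A and s = "\<lambda>_. f"]) auto
qed

text \<open>The values of h are not bounded by the code x. A single number w bounds both of them,
  which leaves one leading quantifier: some values below some w, or all values below every w. The
  two agree because h is total and single-valued.\<close>

lemma ex_low_bit:
  assumes h: "is_function h"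
  shows "\<exists>g. \<forall>x. x \<in>\<^sub>M g \<longleftrightarrow> (\<exists>m n d. m \<prec> n \<and> d \<prec> nm 2 \<and> x = pr (pr m n) d \<and>
     (\<exists>a b. pr (m \<oplus> \<one>) a \<in>\<^sub>M h \<and> pr (n \<oplus> \<one>) b \<in>\<^sub>M h \<and> pr (pr a b) (c \<oplus> c \<oplus> d) \<in>\<^sub>M f))"
    (is "\<exists>g. \<forall>x. _ \<longleftrightarrow> ?P x")
proof -
  define D where "D E = BEx 2 (succ (NVar 0)) (BEx 3 (succ (NVar 0)) (BEx 4 (succ (NVar 0))
    (Conj (Less (NVar 2) (NVar 3)) (Conj (Less (NVar 4) (num 2))
    (Conj (Eq (NVar 0) (pair (pair (NVar 2) (NVar 3)) (NVar 4))) E)))))" for E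
  define Ma where "Ma = Mem (pair (succ (NVar 2)) (NVar 5)) (SVar 1)"
  define Mb where "Mb = Mem (pair (succ (NVar 3)) (NVar 6)) (SVar 1)"
  define Mf where "Mf = Mem (pair (pair (NVar 5) (NVar 6)) (Plus (Plus (NVar 7) (NVar 7)) (NVar 4))) (SVar 0)"
  define A where "A = D (BEx 5 (NVar 1) (BEx 6 (NVar 1) (Conj Ma (Conj Mb Mf))))"
  define B where "B = D (BAll 5 (NVar 1) (BAll 6 (NVar 1) (Imp Ma (Imp Mb Mf))))"
  note defs = D_def Ma_def Mb_def Mf_def
  have "Sigma00 A" "Sigma00 B" unfolding A_def B_def defs by (rule Sigma00_rules | simp)+
  moreover have "conN A = {}" "conS A = {}" "conN B = {}" "conS B = {}"
    by (simp_all add: A_def B_def defs pair_def)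
  moreover have "?P x \<longleftrightarrow> (\<exists>w. sat M ((\<lambda>_. c)(0 := x, 1 := w)) ((\<lambda>_. f)(1 := h)) A)" (is "_ \<longleftrightarrow> ?R") for x
  proof -
    have satA: "sat M ((\<lambda>_. c)(0 := x, 1 := w)) ((\<lambda>_. f)(1 := h)) A \<longleftrightarrow> (\<exists>m n d.
        m \<prec> n \<and> d \<prec> nm 2 \<and> x = pr (pr m n) d \<and>
        (\<exists>a. a \<prec> w \<and> (\<exists>b. b \<prec> w \<and> pr (m \<oplus> \<one>) a \<in>\<^sub>M h \<and> pr (n \<oplus> \<one>) b \<in>\<^sub>M h \<and>
          pr (pr a b) (c \<oplus> c \<oplus> d) \<in>\<^sub>M f)))" for w
      by (subst bounded_ex_pr3[symmetric, where x = x], blast, unfold A_def defs,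
          simp add: sat_logic del: sat.simps(4))
    have bound: "a \<prec> (a \<oplus> b) \<oplus> \<one>" "b \<prec> (a \<oplus> b) \<oplus> \<one>" for a b
      using less_self_add_succ[of a b] less_self_add_succ[of b a] by (simp_all add: add_commute)
    show ?thesis
    proof
      assume "?P x"
      then obtain m n d a b where *: "m \<prec> n" "d \<prec> nm 2" "x = pr (pr m n) d"
        "pr (m \<oplus> \<one>) a \<in>\<^sub>M h" "pr (n \<oplus> \<one>) b \<in>\<^sub>M h" "pr (pr a b) (c \<oplus> c \<oplus> d) \<in>\<^sub>M f" by blast
      show ?R
        \<comment> \<open>This w exceeds both values a and b.\<close>
        unfolding satA using * bound by (rule_tac exI[of _ "(a \<oplus> b) \<oplus> \<one>"]) blast
    next
      assume ?R
      then show "?P x" unfolding satA by blast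
    qed
  qed
  moreover have "?P x \<longleftrightarrow> (\<forall>w. sat M ((\<lambda>_. c)(0 := x, 1 := w)) ((\<lambda>_. f)(1 := h)) B)" for x
  proof -
    have satB: "sat M ((\<lambda>_. c)(0 := x, 1 := w)) ((\<lambda>_. f)(1 := h)) B \<longleftrightarrow> (\<exists>m n d.
        m \<prec> n \<and> d \<prec> nm 2 \<and> x = pr (pr m n) d \<and>
        (\<forall>a. a \<prec> w \<longrightarrow> (\<forall>b. b \<prec> w \<longrightarrow> pr (m \<oplus> \<one>) a \<in>\<^sub>M h \<longrightarrow> pr (n \<oplus> \<one>) b \<in>\<^sub>M h \<longrightarrow>
          pr (pr a b) (c \<oplus> c \<oplus> d) \<in>\<^sub>M f)))" for w
      by (subst bounded_ex_pr3[symmetric, where x = x], blast, unfold B_def defs,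
          simp add: sat_logic del: sat.simps(4))
    show ?thesis
    proof
      assume "?P x"
      then obtain m n d a b where *: "m \<prec> n" "d \<prec> nm 2" "x = pr (pr m n) d"
        "pr (m \<oplus> \<one>) a \<in>\<^sub>M h" "pr (n \<oplus> \<one>) b \<in>\<^sub>M h" "pr (pr a b) (c \<oplus> c \<oplus> d) \<in>\<^sub>M f" by blast
      \<comment> \<open>Single-valuedness of h turns the statement about one pair of values into one
        about all of them.\<close>
      have "a' = a" "b' = b" if "pr (m \<oplus> \<one>) a' \<in>\<^sub>M h" "pr (n \<oplus> \<one>) b' \<in>\<^sub>M h" for a' b'
        using that * h unfolding is_function_def by blast+
      then show "\<forall>w. sat M ((\<lambda>_. c)(0 := x, 1 := w)) ((\<lambda>_. f)(1 := h)) B"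
        unfolding satB using * by blast
    next
      assume R: "\<forall>w. sat M ((\<lambda>_. c)(0 := x, 1 := w)) ((\<lambda>_. f)(1 := h)) B"
      then obtain m n d where *: "m \<prec> n" "d \<prec> nm 2" "x = pr (pr m n) d"
        unfolding satB by blast
      obtain a b where ab: "pr (m \<oplus> \<one>) a \<in>\<^sub>M h" "pr (n \<oplus> \<one>) b \<in>\<^sub>M h"
        using h unfolding is_function_def by blast
      have "a \<prec> (a \<oplus> b) \<oplus> \<one>" "b \<prec> (a \<oplus> b) \<oplus> \<one>"
        using less_self_add_succ[of a b] less_self_add_succ[of b a] by (simp_all add: add_commute)
      \<comment> \<open>Taking w above both values makes the universal form speak about a and b. The
        triple is chosen after w, but x determines it by injectivity of the pairing, so it is the
        triple m, n, d again.\<close>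
      moreover obtain m' n' d' where "x = pr (pr m' n') d'"
        "\<forall>a'. a' \<prec> (a \<oplus> b) \<oplus> \<one> \<longrightarrow> (\<forall>b'. b' \<prec> (a \<oplus> b) \<oplus> \<one> \<longrightarrow> pr (m' \<oplus> \<one>) a' \<in>\<^sub>M h \<longrightarrow>
          pr (n' \<oplus> \<one>) b' \<in>\<^sub>M h \<longrightarrow> pr (pr a' b') (c \<oplus> c \<oplus> d') \<in>\<^sub>M f)"
        using R unfolding satB by blast
      ultimately have "pr (pr a b) (c \<oplus> c \<oplus> d) \<in>\<^sub>M f" using * ab by auto
      then show "?P x" using * ab by blast
    qed
  qed
  ultimately show ?thesis
    \<comment> \<open>The constant assignment stores the parameter c at variable 7.\<close>
    by (rule_tac comprehension[where A = A and B = B and s = "(\<lambda>_. f)(1 := h)" and e = "\<lambda>_. c"])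
qed

text \<open>The value of y at i is an index p into the enumeration given by h, whose entry with
  index p is stored at p + 1 because 0 holds the color. The intermediate value p is the unbounded
  variable: some value p of y at i works, or every one does.\<close>

lemma ex_composition:
  assumes y: "is_function y" and h: "is_function h"
  shows "\<exists>v. \<forall>x. x \<in>\<^sub>M v \<longleftrightarrow> (\<exists>i j. x = pr i j \<and>
     (i = \<zero> \<and> j = c \<or> i \<noteq> \<zero> \<and> (\<exists>a. pr i a \<in>\<^sub>M y \<and> pr (a \<oplus> \<one>) j \<in>\<^sub>M h)))"
    (is "\<exists>v. \<forall>x. _ \<longleftrightarrow> ?P x")
proof -
  define D where "D E = BEx 2 (succ (NVar 0)) (BEx 3 (succ (NVar 0))
    (Conj (Eq (NVar 0) (pair (NVar 2) (NVar 3)))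
      (Disj (Conj (Eq (NVar 2) Zero) (Eq (NVar 3) (NVar 4))) (Conj (Neg (Eq (NVar 2) Zero)) E))))" for E
  define My where "My = Mem (pair (NVar 2) (NVar 1)) (SVar 0)"
  define Mh where "Mh = Mem (pair (succ (NVar 1)) (NVar 3)) (SVar 1)"
  note defs = D_def My_def Mh_def
  define A where "A = D (Conj My Mh)"
  define B where "B = D (Imp My Mh)"
  have "Sigma00 A" "Sigma00 B" unfolding A_def B_def defs by (rule Sigma00_rules | simp)+
  moreover have "conN A = {}" "conS A = {}" "conN B = {}" "conS B = {}"
    by (simp_all add: A_def B_def defs pair_def)
  moreover have "?P x \<longleftrightarrow> (\<exists>w. sat M ((\<lambda>_. c)(0 := x, 1 := w)) ((\<lambda>_. y)(1 := h)) A)" for x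
  proof -
    have "sat M ((\<lambda>_. c)(0 := x, 1 := w)) ((\<lambda>_. y)(1 := h)) A \<longleftrightarrow> (\<exists>i j. x = pr i j \<and>
        (i = \<zero> \<and> j = c \<or> i \<noteq> \<zero> \<and> pr i w \<in>\<^sub>M y \<and> pr (w \<oplus> \<one>) j \<in>\<^sub>M h))" for w
      by (subst bounded_ex_pr2[symmetric, where x = x], blast, unfold A_def defs, simp add: sat_logic, blast)
    then show ?thesis by blast
  qed
  moreover have "?P x \<longleftrightarrow> (\<forall>w. sat M ((\<lambda>_. c)(0 := x, 1 := w)) ((\<lambda>_. y)(1 := h)) B)" for x
  proof -
    have satB: "sat M ((\<lambda>_. c)(0 := x, 1 := w)) ((\<lambda>_. y)(1 := h)) B \<longleftrightarrow> (\<exists>i j. x = pr i j \<and>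
        (i = \<zero> \<and> j = c \<or> i \<noteq> \<zero> \<and> (pr i w \<in>\<^sub>M y \<longrightarrow> pr (w \<oplus> \<one>) j \<in>\<^sub>M h)))" for w
      by (subst bounded_ex_pr2[symmetric, where x = x], blast, unfold B_def defs, simp add: sat_logic, blast)
    show ?thesis
    proof
      assume "?P x"
      then obtain i j where "x = pr i j"
        "i = \<zero> \<and> j = c \<or> i \<noteq> \<zero> \<and> (\<exists>a. pr i a \<in>\<^sub>M y \<and> pr (a \<oplus> \<one>) j \<in>\<^sub>M h)" by blast
      moreover have "a = a'" if "pr i a \<in>\<^sub>M y" "pr i a' \<in>\<^sub>M y" for a a'
        using that y unfolding is_function_def by blast
      ultimately show "\<forall>w. sat M ((\<lambda>_. c)(0 := x, 1 := w)) ((\<lambda>_. y)(1 := h)) B"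
        unfolding satB by blast
    next
      assume R: "\<forall>w. sat M ((\<lambda>_. c)(0 := x, 1 := w)) ((\<lambda>_. y)(1 := h)) B"
      then obtain i j where x: "x = pr i j" unfolding satB by blast
      obtain a where "pr i a \<in>\<^sub>M y" using y unfolding is_function_def by blast
      moreover have "i = \<zero> \<and> j = c \<or> i \<noteq> \<zero> \<and> (pr i a \<in>\<^sub>M y \<longrightarrow> pr (a \<oplus> \<one>) j \<in>\<^sub>M h)"
        using R[rule_format, of a] x unfolding satB by auto
      ultimately show "?P x" using x by blast
    qed
  qed
  \<comment> \<open>The constant assignment stores the new color c at variable 4.\<close>
  ultimately show ?thesis
    by (rule_tac comprehension[where A = A and B = B and s = "(\<lambda>_. y)(1 := h)" and e = "\<lambda>_. c"])
qed

section \<open>Combining the two colorings\<close>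

lemma is_coloring_high_bit:
  assumes f: "is_coloring 4 f"
    and g: "\<And>x. x \<in>\<^sub>M g \<longleftrightarrow> (\<exists>a b c d. a \<prec> b \<and> c \<prec> nm 2 \<and> d \<prec> nm 2 \<and> x = pr (pr a b) c \<and>
      pr (pr a b) (c \<oplus> c \<oplus> d) \<in>\<^sub>M f)"
  shows "is_coloring 2 g"
  unfolding is_coloring_def
proof (intro conjI allI impI)
  fix x assume "x \<in>\<^sub>M g"
  then show "\<exists>a b c. a \<prec> b \<and> c \<prec> nm 2 \<and> x = pr (pr a b) c" unfolding g by blast
next
  fix a b assume "a \<prec> b"
  then obtain k where k: "pr (pr a b) k \<in>\<^sub>M f" using f unfolding is_coloring_def by blast
  then have "k \<prec> nm 4" using f unfolding is_coloring_def by (metis pr_inject)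
  then show "\<exists>c. pr (pr a b) c \<in>\<^sub>M g" using k \<open>a \<prec> b\<close> unfolding less_nm4 g by blast
next
  fix a b c c' assume "pr (pr a b) c \<in>\<^sub>M g \<and> pr (pr a b) c' \<in>\<^sub>M g"
  then obtain d d' where "c \<prec> nm 2" "d \<prec> nm 2" "pr (pr a b) (c \<oplus> c \<oplus> d) \<in>\<^sub>M f"
    "c' \<prec> nm 2" "d' \<prec> nm 2" "pr (pr a b) (c' \<oplus> c' \<oplus> d') \<in>\<^sub>M f"
    unfolding g by auto
  moreover from this have "c \<oplus> c \<oplus> d = c' \<oplus> c' \<oplus> d'" using f unfolding is_coloring_def by blast
  ultimately show "c = c'" using digits_inject by blast
qed

text \<open>The high digit being constantly c on the range of h provides a digit d for every pair of
  indices. Uniqueness of d combines the single values of h with the uniqueness of binary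
  digits.\<close>

lemma is_coloring_low_bit:
  assumes f: "is_coloring 4 f" and h: "is_function h" and c: "c \<prec> nm 2"
    and hom: "\<And>m n a b. m \<prec> n \<Longrightarrow> pr (m \<oplus> \<one>) a \<in>\<^sub>M h \<Longrightarrow> pr (n \<oplus> \<one>) b \<in>\<^sub>M h \<Longrightarrow>
      \<exists>d. d \<prec> nm 2 \<and> pr (pr a b) (c \<oplus> c \<oplus> d) \<in>\<^sub>M f"
    and x: "\<And>z. z \<in>\<^sub>M x \<longleftrightarrow> (\<exists>m n d. m \<prec> n \<and> d \<prec> nm 2 \<and> z = pr (pr m n) d \<and>
      (\<exists>a b. pr (m \<oplus> \<one>) a \<in>\<^sub>M h \<and> pr (n \<oplus> \<one>) b \<in>\<^sub>M h \<and> pr (pr a b) (c \<oplus> c \<oplus> d) \<in>\<^sub>M f))"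
  shows "is_coloring 2 x"
  unfolding is_coloring_def
proof (intro conjI allI impI)
  fix z assume "z \<in>\<^sub>M x"
  then show "\<exists>a b c. a \<prec> b \<and> c \<prec> nm 2 \<and> z = pr (pr a b) c" unfolding x by blast
next
  fix m n assume "m \<prec> n"
  moreover obtain a b where "pr (m \<oplus> \<one>) a \<in>\<^sub>M h" "pr (n \<oplus> \<one>) b \<in>\<^sub>M h"
    using h unfolding is_function_def by blast
  ultimately show "\<exists>d. pr (pr m n) d \<in>\<^sub>M x" using hom unfolding x by blast
next
  fix m n d d' assume "pr (pr m n) d \<in>\<^sub>M x \<and> pr (pr m n) d' \<in>\<^sub>M x"
  then obtain a b a' b' where *: "d \<prec> nm 2" "pr (m \<oplus> \<one>) a \<in>\<^sub>M h" "pr (n \<oplus> \<one>) b \<in>\<^sub>M h"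
    "pr (pr a b) (c \<oplus> c \<oplus> d) \<in>\<^sub>M f" "d' \<prec> nm 2" "pr (m \<oplus> \<one>) a' \<in>\<^sub>M h" "pr (n \<oplus> \<one>) b' \<in>\<^sub>M h"
    "pr (pr a' b') (c \<oplus> c \<oplus> d') \<in>\<^sub>M f"
    unfolding x by auto
  then have "a = a'" "b = b'" using h unfolding is_function_def by blast+
  then have "c \<oplus> c \<oplus> d = c \<oplus> c \<oplus> d'" using * f unfolding is_coloring_def by blast
  then show "d = d'" using digits_inject * c by blast
qed

text \<open>Choosing x before y is what makes this one use; v may depend on y. The choice of x is
  not uniform in f, as it depends on which sets the model contains.\<close>

lemma one_use_in_model:
  "\<exists>x. \<forall>y. (is_coloring 2 x \<longrightarrow> is_monochromatic 2 x y) \<longrightarrow>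
    (\<exists>v. is_coloring 4 f \<longrightarrow> is_monochromatic 4 f v)"
proof (cases "is_coloring 4 f")
  case f: True
  obtain g where "\<forall>x. x \<in>\<^sub>M g \<longleftrightarrow> (\<exists>a b c d. a \<prec> b \<and> c \<prec> nm 2 \<and> d \<prec> nm 2 \<and> x = pr (pr a b) c \<and>
      pr (pr a b) (c \<oplus> c \<oplus> d) \<in>\<^sub>M f)"
    using ex_high_bit[of f] by (rule exE)
  note g = this[rule_format]
  show ?thesis
  proof (cases "\<exists>h. is_monochromatic 2 g h")
    case False
    then show ?thesis using is_coloring_high_bit[OF f g] by blast
  next
    case True
    then obtain h c where h: "is_function h" and c: "c \<prec> nm 2" and hom: "homogeneous g h c"
      unfolding is_monochromatic_def by blast
    obtain x where "\<forall>z. z \<in>\<^sub>M x \<longleftrightarrow> (\<exists>m n d. m \<prec> n \<and> d \<prec> nm 2 \<and> z = pr (pr m n) d \<and>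
      (\<exists>a b. pr (m \<oplus> \<one>) a \<in>\<^sub>M h \<and> pr (n \<oplus> \<one>) b \<in>\<^sub>M h \<and> pr (pr a b) (c \<oplus> c \<oplus> d) \<in>\<^sub>M f))"
      using ex_low_bit[OF h, of c f] by (rule exE)
    note x = this[rule_format]
    have "\<exists>d. d \<prec> nm 2 \<and> pr (pr a b) (c \<oplus> c \<oplus> d) \<in>\<^sub>M f"
      if "m \<prec> n" "pr (m \<oplus> \<one>) a \<in>\<^sub>M h" "pr (n \<oplus> \<one>) b \<in>\<^sub>M h" for m n a b
    proof -
      have "pr (pr a b) c \<in>\<^sub>M g" using hom that unfolding homogeneous_def by blast
      then show ?thesis unfolding g by auto
    qed
    then have "is_coloring 2 x" using is_coloring_low_bit[OF f h c _ x] by blast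
    moreover have "\<exists>v. is_monochromatic 4 f v" if mono: "is_monochromatic 2 x y" for y
    proof -
      obtain d where y: "is_function y" and d: "d \<prec> nm 2" and homy: "homogeneous x y d"
        using mono unfolding is_monochromatic_def by blast
      obtain v where "\<forall>z. z \<in>\<^sub>M v \<longleftrightarrow> (\<exists>i j. z = pr i j \<and> (i = \<zero> \<and> j = c \<oplus> c \<oplus> d \<or>
          i \<noteq> \<zero> \<and> (\<exists>a. pr i a \<in>\<^sub>M y \<and> pr (a \<oplus> \<one>) j \<in>\<^sub>M h)))"
        using ex_composition[OF y h, of "c \<oplus> c \<oplus> d"] by (rule exE)
      note v = this[rule_format]
      have v': "pr i j \<in>\<^sub>M v \<longleftrightarrow> i = \<zero> \<and> j = c \<oplus> c \<oplus> d \<or>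
          i \<noteq> \<zero> \<and> (\<exists>a. pr i a \<in>\<^sub>M y \<and> pr (a \<oplus> \<one>) j \<in>\<^sub>M h)" for i j
        unfolding v by auto
      have "is_function v"
        unfolding is_function_def
      proof (intro conjI allI impI)
        fix z assume "z \<in>\<^sub>M v"
        then show "\<exists>i j. z = pr i j" unfolding v by blast
      next
        fix i
        obtain a where "pr i a \<in>\<^sub>M y" using y unfolding is_function_def by blast
        moreover obtain j where "pr (a \<oplus> \<one>) j \<in>\<^sub>M h" using h unfolding is_function_def by blast
        ultimately show "\<exists>j. pr i j \<in>\<^sub>M v" unfolding v' by blast
      next
        fix i j j' assume "pr i j \<in>\<^sub>M v \<and> pr i j' \<in>\<^sub>M v"
        then show "j = j'" using y h unfolding v' is_function_def by metis
      qed
      moreover have "c \<oplus> c \<oplus> d \<prec> nm 4" using c d less_nm4 by blast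
      moreover have "pr \<zero> (c \<oplus> c \<oplus> d) \<in>\<^sub>M v" unfolding v' by simp
      moreover have "homogeneous f v (c \<oplus> c \<oplus> d)"
        unfolding homogeneous_def
      proof (intro allI impI, elim conjE)
        fix m n a b assume mn: "m \<prec> n" and "pr (m \<oplus> \<one>) a \<in>\<^sub>M v" "pr (n \<oplus> \<one>) b \<in>\<^sub>M v"
        then obtain p q where p: "pr (m \<oplus> \<one>) p \<in>\<^sub>M y" "pr (p \<oplus> \<one>) a \<in>\<^sub>M h"
          and q: "pr (n \<oplus> \<one>) q \<in>\<^sub>M y" "pr (q \<oplus> \<one>) b \<in>\<^sub>M h"
          unfolding v' by auto
        \<comment> \<open>Here p and q are indices into h. The color d of x at the indices carries
          over to the values of h, and these are a and b as h is single-valued.\<close>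
        have pq: "p \<prec> q" "pr (pr p q) d \<in>\<^sub>M x"
          using homy mn p q unfolding homogeneous_def by blast+
        then obtain a' b' where "pr (p \<oplus> \<one>) a' \<in>\<^sub>M h" "pr (q \<oplus> \<one>) b' \<in>\<^sub>M h"
          "pr (pr a' b') (c \<oplus> c \<oplus> d) \<in>\<^sub>M f"
          unfolding x by auto
        moreover from this have "a' = a" "b' = b" using p q h unfolding is_function_def by blast+
        moreover have "a \<prec> b" using hom pq p q unfolding homogeneous_def by blast
        ultimately show "a \<prec> b \<and> pr (pr a b) (c \<oplus> c \<oplus> d) \<in>\<^sub>M f" by blast
      qed
      ultimately show ?thesis unfolding is_monochromatic_def by blast
    qed
    ultimately show ?thesis by blast
  qed
\<comment> \<open>If f is not a coloring, the implication required of v holds vacuously.\<close>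
qed blast

end

section \<open>The deduction\<close>

text \<open>With both set terms as arguments, substitution for set variables acts on the arguments
  alone: the formula quantifies over numbers only.\<close>

definition RT2_post :: "nat \<Rightarrow> sterm \<Rightarrow> sterm \<Rightarrow> fm" where
  "RT2_post k F X = Imp (coloring k F) (monochromatic k F X)"

lemmas RT2_post_unfold = RT2_post_def coloring_def monochromatic_def total_function_def Let_def pair_def

lemma subS_RT2_post [simp]: "subS \<sigma> (RT2_post k F X) = RT2_post k (sub_sterm \<sigma> F) (sub_sterm \<sigma> X)"
  by (simp add: RT2_post_unfold)

lemma free_forS_RT2_post [simp]: "free_forS \<sigma> (RT2_post k F X)"
  by (simp add: RT2_post_unfold)

lemma fv_RT2_post [simp]:
  "fvN (RT2_post k F X) = {}" "fvS (RT2_post k F X) = fv_sterm F \<union> fv_sterm X"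
  "conN (RT2_post k F X) = {}" "conS (RT2_post k F X) = con_sterm F \<union> con_sterm X"
  by (auto simp: RT2_post_unfold)

text \<open>Variables 3 and 1 stand for the solution y and the result v. They differ from the
  variables 0 and 2 that the full sentence uses for u and x.\<close>

definition one_use_body :: "sterm \<Rightarrow> sterm \<Rightarrow> fm" where
  "one_use_body U X = AllS 3 (Imp (RT2_post 2 X (SVar 3)) (ExS 1 (RT2_post 4 U (SVar 1))))"

lemma prov_one_use: "prov RCA0 (AllS 0 (ExS 2 (one_use_body (SVar 0) (SVar 2))))" (is "prov _ ?P")
proof (rule completeness)
  show "sentence ?P" by (auto simp: sentence_def one_use_body_def)
next
  fix M :: "(nat, nat) interp" and e s
  assume "\<And>B e s. B \<in> RCA0 \<Longrightarrow> sat M e s B"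
  then interpret RCA0_model M by unfold_locales
  show "sat M e s ?P"
    using one_use_in_model
    by (simp add: one_use_body_def RT2_post_def sat_logic sat_coloring sat_monochromatic del: sat.simps(4))
qed (auto intro: sentence_RCA0 RCA0_num_distinct)

theorem theorem3p4:
  shows "one_typical_use RCA0 (RT2 4) (RT2 2)"
proof -
  let ?P = "AllS 0 (ExS 2 (one_use_body (SVar 0) (SVar 2)))"
  obtain F where "finite F" and F: "\<forall>V G s L. V \<inter> F = {} \<longrightarrow> ded RCA0 G V s (L, []) \<longrightarrow>
    (\<exists>L'. set L \<subseteq> set L' \<and> ?P \<in> set L' \<and> ded RCA0 G V s (L', []))"
    using ded_of_prov[OF prov_one_use] by blast
  \<comment> \<open>Outside F, the variable u is never generalized in the derivation; apart from 0
    to 3, it is not captured when it instantiates the sentence.\<close>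
  then have "finite (F \<union> {0,1,2,3})" by simp
  then obtain u where u: "u \<notin> F \<union> {0,1,2,3}"
    using ex_new_if_finite[OF infinite_UNIV_nat] by blast
  then obtain L where P: "?P \<in> set L" and L: "ded RCA0 {} {u} ([], []) (L, [])"
    using F[rule_format, of "{u}" "{}" "([], [])" "[]"] ded.Start by auto
  \<comment> \<open>N contains the set constants of the derivation. The constants C for x, y for the
    solution and v for the result are new and distinct from each other.\<close>
  define N where "N = \<Union>(conS ` set L)"
  have "finite N" by (simp add: N_def)
  then obtain C where C: "C \<notin> N"
    using ex_new_if_finite[OF infinite_UNIV_nat] by blast
  obtain y where y: "y \<notin> insert C N"
    using ex_new_if_finite[OF infinite_UNIV_nat, of "insert C N"] \<open>finite N\<close> by blast
  obtain v where v: "v \<notin> insert y (insert C N)"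
    using ex_new_if_finite[OF infinite_UNIV_nat, of "insert y (insert C N)"] \<open>finite N\<close> by blast
  have RCA0: "conS B = {}" if "B \<in> RCA0" for B
    using sentence_RCA0[OF that] by (simp add: sentence_def)
  let ?E1 = "ExS 2 (one_use_body (SVar u) (SVar 2))"
  let ?E2 = "one_use_body (SVar u) (SCon C)"
  let ?L0 = "?E2 # ?E1 # Imp ?P ?E1 # L"
  let ?p = "RT2_post 2 (SCon C) (SCon y)"
  let ?q = "ExS 1 (RT2_post 4 (SVar u) (SVar 1))"
  have "free_forS (SVar(0 := SVar u)) (ExS 2 (one_use_body (SVar 0) (SVar 2)))"
    using u by (auto simp: one_use_body_def)
  from logical_axioms.InstS[OF this] have inst1: "Imp ?P ?E1 \<in> logical_axioms"
    by (simp add: one_use_body_def)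
  have "ded RCA0 {} {u} ([], []) (Imp ?P ?E1 # L, [])"
    using inst1 by (intro ded.Axiom[OF L]) blast
  then have "ded RCA0 {} {u} ([], []) (?E1 # Imp ?P ?E1 # L, [])"
    using P by (rule_tac ded.MP[where A = ?P]) auto
  \<comment> \<open>Naming x before the two deductions part makes \<open>SCon C\<close> denote the
    same set in both.\<close>
  then have "ded RCA0 {} {u} ([], [])
      (subS (SVar(2 := SCon C)) (one_use_body (SVar u) (SVar 2)) # ?E1 # Imp ?P ?E1 # L, [?E1])"
    using C by (rule_tac ded.RuleCS) (auto simp: RCA0 N_def one_use_body_def)
  moreover have "subS (SVar(2 := SCon C)) (one_use_body (SVar u) (SVar 2)) = ?E2"
    using u by (simp add: one_use_body_def)
  ultimately have L0: "ded RCA0 {} {u} ([], []) (?L0, [?E1])" by simp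
  \<comment> \<open>Both preconditions are the same formula, so the assumption is already the
    required line.\<close>
  have L1: "ded RCA0 {Eq Zero Zero} {u} (?L0, [?E1]) (Eq Zero Zero # ?L0, [?E1])"
    by (intro ded.Assumption ded.Start) simp
  have "free_forS (SVar(3 := SCon y)) (Imp (RT2_post 2 (SCon C) (SVar 3)) ?q)" by simp
  from logical_axioms.InstS[OF this] have inst2: "Imp ?E2 (Imp ?p ?q) \<in> logical_axioms"
    using u by (simp add: one_use_body_def)
  let ?L2 = "?q # Imp ?p ?q # Imp ?E2 (Imp ?p ?q) # ?p # ?L0"
  have "ded RCA0 {?p} {u} (?L0, [?E1]) (?p # ?L0, [?E1])"
    by (intro ded.Assumption ded.Start) simp
  then have "ded RCA0 {?p} {u} (?L0, [?E1]) (Imp ?E2 (Imp ?p ?q) # ?p # ?L0, [?E1])"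
    using inst2 by (rule_tac ded.Axiom) auto
  then have "ded RCA0 {?p} {u} (?L0, [?E1]) (Imp ?p ?q # Imp ?E2 (Imp ?p ?q) # ?p # ?L0, [?E1])"
    by (rule ded.MP[where A = ?E2]) auto
  then have "ded RCA0 {?p} {u} (?L0, [?E1]) (?L2, [?E1])"
    by (rule ded.MP[where A = ?p]) auto
  \<comment> \<open>The result depends on y, so it is named only in this continuation. Its constant
    must also be new to the assumption, which contains C and y.\<close>
  then have "ded RCA0 {?p} {u} (?L0, [?E1])
      (subS (SVar(1 := SCon v)) (RT2_post 4 (SVar u) (SVar 1)) # ?L2, ?q # [?E1])"
    using v by (rule_tac ded.RuleCS) (auto simp: RCA0 N_def one_use_body_def)
  moreover have "subS (SVar(1 := SCon v)) (RT2_post 4 (SVar u) (SVar 1)) = RT2_post 4 (SVar u) (SCon v)"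
    using u by simp
  ultimately have L2: "ded RCA0 {?p} {u} (?L0, [?E1]) (RT2_post 4 (SVar u) (SCon v) # ?L2, [?q, ?E1])"
    by simp
  have RT2: "RT2 k = \<lparr>inp = 0, out = 1, pre = Eq Zero Zero, post = RT2_post k (SVar 0) (SVar 1)\<rparr>" for k
    by (simp add: RT2_def RT2_post_def)
  have fresh: "\<forall>B \<in> set ?L0 \<union> RCA0. y \<notin> conS B"
    using y by (auto simp: RCA0 N_def one_use_body_def)
  \<comment> \<open>The terms for x and v are constants without free variables, so u is the only
    variable to be protected from generalization.\<close>
  show ?thesis
    unfolding one_typical_use_def RT2 Let_def
    by (rule exI[of _ u], rule exI[of _ "SCon C"], rule exI[of _ y], rule exI[of _ "SCon v"],
        rule exI[of _ ?L0], rule exI[of _ "[?E1]"], rule exI[of _ "Eq Zero Zero # ?L0"],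
        rule exI[of _ "[?E1]"], rule exI[of _ "RT2_post 4 (SVar u) (SCon v) # ?L2"],
        rule exI[of _ "[?q, ?E1]"])
      (use L0 L1 L2 fresh y in auto)
qed

end
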